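(* Let $n\ge 3$, let $\eta$ be a primitive $n$-th root of unity, $L=\mathbb{Q}(\eta)$, and let $C=\langle g_0\rangle$ be a cyclic group of order $n$ with character $\chi$ given by $\chi(g_0)=\eta$. Let $\sigma\in\mathrm{Gal}(L/\mathbb{Q})\cong(\mathbb{Z}/n\mathbb{Z})^*$ be an element of order two, and let $K=L^{\sigma}$ be its fixed field, with ring of integers $\mathcal{O}_K$. Let $\rho:C\to\mathrm{GL}_2(K)$ be a representation with character $\chi+\sigma\circ\chi$ (for instance $\rho(g_0)=\begin{pmatrix}0&\delta\\-1&\tau\end{pmatrix}$ with $\tau=\eta+\sigma(\eta)$, $\delta=\eta\sigma(\eta)$). Then the number of $\mathrm{GL}_2(\mathcal{O}_K)$-conjugacy classes of homomorphisms $C\to\mathrm{GL}_2(\mathcal{O}_K)$ that are $\mathrm{GL}_2(K)$-conjugate to $\rho$ is precisely $h_{L/K}$.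
   Context: For a number field $F$, $\mathcal{I}_F$ is the group of nonzero fractional ideals of $\mathcal{O}_F$, $\mathcal{P}_F$ the subgroup of principal ones. The relative class number $h_{L/K}$ is the order of $\mathcal{G}_{L/K}=N_{L/K}^{-1}(\mathcal{P}_K)/\mathcal{P}_L$, i.e. the number of ideal classes $[J]$ of $L$ whose norm $N_{L/K}(J)$ is a principal ideal of $K$. *)

theory Defs
  imports "HOL-Analysis.Analysis" "HOL-Algebra.Coset" "HOL-Algebra.Generated_Groups"
begin

text \<open>
  Number fields are subsets of an ambient field of characteristic \<open>0\<close>, which is given by a type.
\<close>

definition primitive_root_of_unity :: "nat \<Rightarrow> 'a::field \<Rightarrow> bool" where
  "primitive_root_of_unity n z \<longleftrightarrow> n > 0 \<and> z ^ n = 1 \<and> (\<forall>k. 0 < k \<and> k < n \<longrightarrow> z ^ k \<noteq> 1)"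

definition is_subfield :: "'a::field set \<Rightarrow> bool" where
  "is_subfield F \<longleftrightarrow> 0 \<in> F \<and> 1 \<in> F \<and>
     (\<forall>x\<in>F. \<forall>y\<in>F. x + y \<in> F \<and> x * y \<in> F) \<and> (\<forall>x\<in>F. - x \<in> F \<and> inverse x \<in> F)"

definition adjoin :: "'a::field set \<Rightarrow> 'a \<Rightarrow> 'a set" where
  "adjoin F x = is_subfield hull (insert x F)"

text \<open>Extensionality makes an automorphism of \<open>L\<close> a single function on the ambient type.\<close>

definition Gal :: "'a::field set \<Rightarrow> 'a set \<Rightarrow> ('a \<Rightarrow> 'a) set" where
  "Gal L K = {s \<in> extensional L. bij_betw s L L \<and>
     (\<forall>x\<in>L. \<forall>y\<in>L. s (x + y) = s x + s y \<and> s (x * y) = s x * s y) \<and> (\<forall>x\<in>K. s x = x)}"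

definition fixed_field :: "'a set \<Rightarrow> ('a \<Rightarrow> 'a) \<Rightarrow> 'a set" where
  "fixed_field L s = {x \<in> L. s x = x}"

definition ring_of_integers :: "'a::field set \<Rightarrow> 'a set" where
  "ring_of_integers F = {x \<in> F. algebraic_int x}"

definition is_submodule :: "'a::field set \<Rightarrow> 'a set \<Rightarrow> bool" where
  "is_submodule R M \<longleftrightarrow>
     0 \<in> M \<and> (\<forall>x\<in>M. \<forall>y\<in>M. x + y \<in> M) \<and> (\<forall>r\<in>R. \<forall>x\<in>M. r * x \<in> M)"

definition fractional_ideals :: "'a::field set \<Rightarrow> 'a set set" where
  "fractional_ideals F = {J. J \<subseteq> F \<and> is_submodule (ring_of_integers F) J \<and> J \<noteq> {0} \<and>
     (\<exists>d\<in>ring_of_integers F. d \<noteq> 0 \<and> (\<forall>x\<in>J. d * x \<in> ring_of_integers F))}"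

definition principal_ideals :: "'a::field set \<Rightarrow> 'a set set" where
  "principal_ideals F = {(\<lambda>r. r * x) ` ring_of_integers F | x. x \<in> F \<and> x \<noteq> 0}"

definition ideal_group :: "'a::field set \<Rightarrow> 'a set monoid" where
  "ideal_group F = \<lparr>carrier = fractional_ideals F,
     mult = (\<lambda>I J. is_submodule (ring_of_integers F) hull {x * y | x y. x \<in> I \<and> y \<in> J}),
     one = ring_of_integers F\<rparr>"

text \<open>
  The next two definitions give the relative norm of elements and of fractional ideals for a finite
  Galois extension \<open>L/K\<close> of number fields.  The norm of \<open>J\<close> is the fractional ideal of \<open>K\<close> generated
  by the norms of the elements of \<open>J\<close>.
\<close>

definition rel_norm :: "'a::field set \<Rightarrow> 'a set \<Rightarrow> 'a \<Rightarrow> 'a" where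
  "rel_norm L K x = (\<Prod>s\<in>Gal L K. s x)"

definition rel_ideal_norm :: "'a::field set \<Rightarrow> 'a set \<Rightarrow> 'a set \<Rightarrow> 'a set" where
  "rel_ideal_norm L K J = is_submodule (ring_of_integers K) hull (rel_norm L K ` J)"

definition rel_class_group :: "'a::field set \<Rightarrow> 'a set \<Rightarrow> 'a set set monoid" where
  "rel_class_group L K =
     (ideal_group L)\<lparr>carrier := {J \<in> fractional_ideals L. rel_ideal_norm L K J \<in> principal_ideals K}\<rparr>
       Mod principal_ideals L"

definition rel_class_number :: "'a::field set \<Rightarrow> 'a set \<Rightarrow> nat" where
  "rel_class_number L K = Coset.order (rel_class_group L K)"

definition mult_group :: "'a::field set \<Rightarrow> 'a monoid" where
  "mult_group F = \<lparr>carrier = F - {0}, mult = (*), one = 1\<rparr>"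

definition GL2 :: "'a::field set \<Rightarrow> ('a^2^2) monoid" where
  "GL2 R = \<lparr>carrier = {A. (\<forall>i j. A $ i $ j \<in> R) \<and>
       (\<exists>B. (\<forall>i j. B $ i $ j \<in> R) \<and> A ** B = mat 1 \<and> B ** A = mat 1)},
     mult = (**), one = mat 1\<rparr>"

definition conjugate_homs ::
    "('g, 'b) monoid_scheme \<Rightarrow> ('h, 'c) monoid_scheme \<Rightarrow> ('g \<Rightarrow> 'h) \<Rightarrow> ('g \<Rightarrow> 'h) \<Rightarrow> bool" where
  "conjugate_homs G H \<phi> \<psi> \<longleftrightarrow>
     (\<exists>P\<in>carrier H. \<forall>g\<in>carrier G. \<psi> g = P \<otimes>\<^bsub>H\<^esub> \<phi> g \<otimes>\<^bsub>H\<^esub> inv\<^bsub>H\<^esub> P)"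

definition conjugacy_classes ::
    "('g, 'b) monoid_scheme \<Rightarrow> ('h, 'c) monoid_scheme \<Rightarrow> ('g \<Rightarrow> 'h) set \<Rightarrow> ('g \<Rightarrow> 'h) set set" where
  "conjugacy_classes G H X = X // {(\<phi>, \<psi>). \<phi> \<in> X \<and> \<psi> \<in> X \<and> conjugate_homs G H \<phi> \<psi>}"

text \<open>
  Homomorphisms into \<open>GL2 R\<close> that become conjugate to \<open>\<rho>\<close> over \<open>K\<close>; the functions are extensional so
  that each homomorphism is counted once.
\<close>

definition homs_conjugate_to ::
    "('g, 'b) monoid_scheme \<Rightarrow> 'a::field set \<Rightarrow> 'a set \<Rightarrow> ('g \<Rightarrow> 'a^2^2) \<Rightarrow> ('g \<Rightarrow> 'a^2^2) set" where
  "homs_conjugate_to G R K \<rho> =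
     {\<phi> \<in> hom G (GL2 R) \<inter> extensional (carrier G). conjugate_homs G (GL2 K) \<rho> \<phi>}"

end

theory Submission
  imports "Jordan_Normal_Form.Char_Poly" "HOL-Number_Theory.Residues" Defs
begin

text \<open>
  A homomorphism \<open>\<phi>\<close> that is conjugate to \<open>\<rho>\<close> over \<open>K\<close> has a vector \<open>v\<close> over \<open>L\<close> with
  \<open>\<phi> g v = \<chi> g v\<close>, unique up to scaling. Its entries form a \<open>K\<close>-basis of \<open>L\<close>, and if \<open>\<phi>\<close> takes values
  in \<open>GL\<^sub>2(O\<^sub>K)\<close>, then the \<open>O\<^sub>K\<close>-lattice spanned by them is stable under \<open>\<eta>\<close>. Since
  \<open>O\<^sub>L = \<int>[\<eta>] = O\<^sub>K + O\<^sub>K \<eta>\<close>, it is a fractional ideal of \<open>L\<close>. A change of basis of the lattice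
  conjugates \<open>\<phi>\<close>, so the conjugacy classes correspond to the classes of those fractional ideals
  that are free over \<open>O\<^sub>K\<close>. These are the ideals with principal relative norm: writing
  \<open>J = A \<oplus> B s\<close> with fractional ideals \<open>A\<close>, \<open>B\<close> of \<open>K\<close> and \<open>s \<in> L\<close>, the norm of \<open>J\<close> is \<open>A B\<close>.

  The equality \<open>O\<^sub>L = \<int>[\<eta>]\<close> comes from reducedness: for a prime \<open>p\<close> dividing \<open>n = p\<^sup>e m\<close>, some power
  \<open>q\<close> of \<open>p\<close> satisfies \<open>y\<^sup>q \<equiv> y\<close> modulo \<open>1 - \<eta>\<^sup>m\<close> on \<open>\<int>[\<eta>]\<close>, and \<open>p\<close> divides a power of \<open>1 - \<eta>\<^sup>m\<close>.
  The ideal theory of \<open>O\<^sub>K\<close> only uses that the quotients \<open>O\<^sub>K/N\<close> are finite.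
\<close>

section \<open>Subrings and integrality\<close>

text \<open>Freeness over \<open>O_K\<close> is governed by the Steinitz class. For a fractional
  ideal \<open>J\<close> of \<open>L\<close> this is in general the class of its norm times the
  Steinitz class of \<open>O_L\<close>. The norm alone decides here because \<open>O_L\<close> is
  free over \<open>O_K\<close> with basis \<open>1\<close>, \<open>\<eta>\<close>: this is the
  second role of the equality with \<open>\<int>[\<eta>]\<close>, besides turning stability under
  \<open>\<eta>\<close> into stability under \<open>O_L\<close>. The two facts about ideals of
  \<open>O_K\<close> that enter, invertibility and generation by two elements, both come from finite
  rings \<open>O_K/N\<close>. There the powers of an element repeat, which yields annihilators of
  proper ideals, and some power is idempotent, which splits the ring so that two generators can be
  merged into one. Conjugacy is handled on one vector: since the entries of \<open>v\<close> are
  independent over \<open>K\<close>, a matrix over \<open>K\<close> is determined by its value at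
  \<open>v\<close>, and matrix identities become identities between multiples of
  \<open>v\<close>.\<close>

hide_const (open) up_ring.coeff
no_notation Matrix.vec_index (infixl "$" 100)

text \<open>An eigenvalue of an integer matrix is a root of its characteristic polynomial, which is
  monic. This is how elements of \<open>\<int>[\<eta>]\<close> are recognised as algebraic
  integers.\<close>

lemma algebraic_int_if_integer_eigenvector:
  fixes y :: "'a::field_char_0" and v :: "nat \<Rightarrow> 'a" and M :: "nat \<Rightarrow> nat \<Rightarrow> int"
  assumes k: "k < n" "v k \<noteq> 0"
    and ev: "\<And>i. i < n \<Longrightarrow> y * v i = (\<Sum>j<n. of_int (M i j) * v j)"
  shows "algebraic_int y"
proof -
  define A where "A = Matrix.mat n n (\<lambda>(i, j). M i j)"
  define B where "B = (map_mat of_int A :: 'a Matrix.mat)"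
  have A: "A \<in> carrier_mat n n" and B: "B \<in> carrier_mat n n"
    by (auto simp: A_def B_def)
  have "eigenvector B (Matrix.vec n v) y"
    unfolding eigenvector_def
  proof (intro conjI)
    show "Matrix.vec n v \<in> carrier_vec (dim_row B)"
      using B by auto
    show "Matrix.vec n v \<noteq> 0\<^sub>v (dim_row B)"
      using k B by (metis carrier_matD(1) index_vec index_zero_vec(1))
    show "B *\<^sub>v Matrix.vec n v = y \<cdot>\<^sub>v Matrix.vec n v"
      using B ev
      by (intro eq_vecI) (auto simp: scalar_prod_def A_def B_def atLeast0LessThan)
  qed
  then have "poly (char_poly B) y = 0"
    using eigenvalue_root_char_poly[OF B] by (auto simp: eigenvalue_def)
  moreover have "char_poly B = map_poly of_int (char_poly A)"
    unfolding B_def by (rule of_int_hom.char_poly_hom[OF A])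
  moreover have "lead_coeff (char_poly A) = 1"
    using degree_monic_char_poly[OF A] by auto
  ultimately show ?thesis
    unfolding algebraic_int_altdef_ipoly by auto
qed

definition is_subring :: "'a::field set \<Rightarrow> bool" where
  "is_subring R \<longleftrightarrow> 1 \<in> R \<and> (\<forall>x\<in>R. \<forall>y\<in>R. x - y \<in> R \<and> x * y \<in> R)"

context
  fixes R :: "'a::field set"
  assumes R: "is_subring R"
begin

lemma subring_one: "1 \<in> R" and subring_diff: "x \<in> R \<Longrightarrow> y \<in> R \<Longrightarrow> x - y \<in> R"
  and subring_mult: "x \<in> R \<Longrightarrow> y \<in> R \<Longrightarrow> x * y \<in> R"
  using R by (auto simp: is_subring_def)

lemma subring_zero: "0 \<in> R"
  using subring_diff[OF subring_one subring_one] by simp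

lemma subring_minus: "x \<in> R \<Longrightarrow> - x \<in> R"
  using subring_diff[OF subring_zero, of x] by simp

lemma subring_add: "x \<in> R \<Longrightarrow> y \<in> R \<Longrightarrow> x + y \<in> R"
  using subring_diff[of x "- y"] subring_minus[of y] by simp

lemma subring_power: "x \<in> R \<Longrightarrow> x ^ k \<in> R"
  by (induction k) (auto intro: subring_one subring_mult)

lemma subring_sum: "(\<And>i. i \<in> A \<Longrightarrow> f i \<in> R) \<Longrightarrow> sum f A \<in> R"
  by (induction A rule: infinite_finite_induct) (auto intro: subring_zero subring_add)

lemma subring_prod: "(\<And>i. i \<in> A \<Longrightarrow> f i \<in> R) \<Longrightarrow> prod f A \<in> R"
  by (induction A rule: infinite_finite_induct) (auto intro: subring_one subring_mult)

lemma subring_of_nat: "of_nat k \<in> R"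
  by (induction k) (auto intro: subring_zero subring_one subring_add)

lemma subring_of_int: "of_int k \<in> R"
  by (cases k) (auto intro!: subring_of_nat subring_minus simp del: of_nat_Suc)

lemmas subring_intros = subring_one subring_zero subring_minus subring_add subring_diff
  subring_mult subring_power subring_sum subring_prod subring_of_nat subring_of_int

text \<open>Membership in the image of \<open>R\<close> under multiplication by \<open>l\<close> is
  divisibility by \<open>l\<close> in \<open>R\<close>; a difference in this image is a congruence
  modulo \<open>l\<close>. Quotient rings are never formed.\<close>

lemma multiple_zero: "0 \<in> (*) l ` R"
  using subring_zero by force

lemma multiple_add: "x \<in> (*) l ` R \<Longrightarrow> y \<in> (*) l ` R \<Longrightarrow> x + y \<in> (*) l ` R"
  by (auto simp flip: distrib_left intro: subring_add)

lemma multiple_diff: "x \<in> (*) l ` R \<Longrightarrow> y \<in> (*) l ` R \<Longrightarrow> x - y \<in> (*) l ` R"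
  by (auto simp flip: right_diff_distrib intro: subring_diff)

lemma multiple_mult: "x \<in> (*) l ` R \<Longrightarrow> y \<in> R \<Longrightarrow> x * y \<in> (*) l ` R"
  by (auto simp: mult.assoc intro: subring_mult)

lemma multiple_power_diff:
  assumes "x \<in> R" "y \<in> R" "x - y \<in> (*) l ` R"
  shows "x ^ k - y ^ k \<in> (*) l ` R"
proof (induction k)
  case 0
  then show ?case by (simp add: multiple_zero)
next
  case (Suc k)
  have "x ^ Suc k - y ^ Suc k = (x - y) * x ^ k + (x ^ k - y ^ k) * y"
    by (simp add: algebra_simps)
  then show ?case
    using Suc assms by (auto intro!: multiple_add multiple_mult subring_power)
qed

lemma add_power_prime_multiple:
  assumes "prime p" "x \<in> R" "y \<in> R"
  shows "(x + y) ^ p - (x ^ p + y ^ p) \<in> (*) (of_nat p) ` R"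
proof -
  define c where "c = (\<Sum>k\<in>{1..<p}. of_nat ((p choose k) div p) * x ^ k * y ^ (p - k))"
  have p: "p > 1"
    using assms(1) prime_gt_1_nat by blast
  have "{..p} = insert 0 (insert p {1..<p})"
    using p by auto
  then have "(x + y) ^ p = y ^ p + (x ^ p + (\<Sum>k\<in>{1..<p}. of_nat (p choose k) * x ^ k * y ^ (p - k)))"
    unfolding binomial_ring using p by simp
  also have "(\<Sum>k\<in>{1..<p}. of_nat (p choose k) * x ^ k * y ^ (p - k)) = of_nat p * c"
    unfolding c_def sum_distrib_left
  proof (rule sum.cong)
    fix k assume "k \<in> {1..<p}"
    then have "p dvd (p choose k)"
      using assms(1) by (intro dvd_choose_prime) auto
    then have "of_nat (p choose k) = (of_nat p * of_nat ((p choose k) div p) :: 'a)"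
      by (metis dvd_mult_div_cancel of_nat_mult)
    then show "of_nat (p choose k) * x ^ k * y ^ (p - k)
        = of_nat p * (of_nat ((p choose k) div p) * x ^ k * y ^ (p - k))"
      by (simp add: mult.assoc)
  qed simp
  finally have "(x + y) ^ p - (x ^ p + y ^ p) = of_nat p * c"
    by simp
  moreover have "c \<in> R"
    unfolding c_def using assms by (intro subring_intros)
  ultimately show ?thesis
    by blast
qed

text \<open>Raising the congruence for \<open>p ^ r\<close> to the power \<open>p\<close> and
  applying the binomial congruence modulo \<open>p\<close> gives the one for
  \<open>p ^ Suc r\<close>, as \<open>p\<close> vanishes modulo \<open>l\<close>.\<close>

lemma add_power_prime_power_multiple:
  assumes p: "prime p" "of_nat p \<in> (*) l ` R" and xy: "x \<in> R" "y \<in> R"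
  shows "(x + y) ^ (p ^ r) - (x ^ (p ^ r) + y ^ (p ^ r)) \<in> (*) l ` R"
proof (induction r)
  case 0
  then show ?case by (simp add: multiple_zero)
next
  case (Suc r)
  let ?x = "x ^ (p ^ r)" and ?y = "y ^ (p ^ r)"
  have "((x + y) ^ (p ^ r)) ^ p - (?x + ?y) ^ p \<in> (*) l ` R"
    by (intro multiple_power_diff Suc subring_intros xy)
  moreover have "(?x + ?y) ^ p - (?x ^ p + ?y ^ p) \<in> (*) (of_nat p) ` R"
    by (intro add_power_prime_multiple p subring_intros xy)
  then obtain c where "c \<in> R" "(?x + ?y) ^ p - (?x ^ p + ?y ^ p) = of_nat p * c"
    by blast
  then have "(?x + ?y) ^ p - (?x ^ p + ?y ^ p) \<in> (*) l ` R"
    using p(2) by (auto intro: multiple_mult)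
  ultimately have "(((x + y) ^ (p ^ r)) ^ p - (?x + ?y) ^ p) + ((?x + ?y) ^ p - (?x ^ p + ?y ^ p)) \<in> (*) l ` R"
    by (rule multiple_add)
  then have "((x + y) ^ (p ^ r)) ^ p - (?x ^ p + ?y ^ p) \<in> (*) l ` R"
    by (simp only: add_diff_eq diff_add_cancel)
  then show ?case
    by (simp only: power_Suc2 power_mult)
qed

text \<open>The monic equation is written out with a coefficient function, because \<open>R\<close>
  is a set and not a type of coefficients.\<close>

definition integral_over :: "'a \<Rightarrow> bool" where
  "integral_over x \<longleftrightarrow> (\<exists>d a. (\<forall>i<d. a i \<in> R) \<and> x ^ d = (\<Sum>i<d. a i * x ^ i))"

lemma integral_over_mult:
  assumes "integral_over x" "c \<in> R"
  shows "integral_over (c * x)"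
proof -
  obtain d a where a: "\<And>i. i < d \<Longrightarrow> a i \<in> R" and x: "x ^ d = (\<Sum>i<d. a i * x ^ i)"
    using assms(1) unfolding integral_over_def by auto
  have "(c * x) ^ d = (\<Sum>i<d. c ^ (d - i) * a i * (c * x) ^ i)"
    unfolding power_mult_distrib x sum_distrib_left
    by (intro sum.cong) (auto simp: mult_ac simp flip: power_add)
  moreover have "\<forall>i<d. c ^ (d - i) * a i \<in> R"
    using assms(2) a by (auto intro: subring_intros)
  ultimately show ?thesis
    unfolding integral_over_def by (intro exI[of _ d] exI[of _ "\<lambda>i. c ^ (d - i) * a i"]) auto
qed

text \<open>The hypothesis on \<open>q\<close> makes the quotient of \<open>R\<close> by \<open>l\<close> reduced, and an integral equation for
  \<open>x\<close> shows that \<open>l * x\<close> is nilpotent in this quotient.\<close>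

lemma integral_over_cancel:
  assumes "l \<in> R" "l \<noteq> 0" "integral_over x" "l * x \<in> R" "q > 1"
    and q: "\<And>y. y \<in> R \<Longrightarrow> y ^ q - y \<in> (*) l ` R"
  shows "x \<in> R"
proof -
  obtain d a where a: "\<And>i. i < d \<Longrightarrow> a i \<in> R" and x: "x ^ d = (\<Sum>i<d. a i * x ^ i)"
    using assms(3) unfolding integral_over_def by auto
  define y where "y = l * x"
  have y: "y \<in> R"
    using assms(4) by (simp add: y_def)
  have "y ^ d = l * (\<Sum>i<d. l ^ (d - i - 1) * a i * y ^ i)"
    unfolding y_def power_mult_distrib x sum_distrib_left
  proof (intro sum.cong)
    fix i assume "i \<in> {..<d}"
    then have "l ^ d = l * l ^ (d - i - 1) * l ^ i"
      by (simp only: power_add [symmetric] power_Suc [symmetric]) simp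
    then show "l ^ d * (a i * x ^ i) = l * (l ^ (d - i - 1) * a i * (l ^ i * x ^ i))"
      by simp
  qed simp
  then have yd: "y ^ d \<in> (*) l ` R"
    using assms(1) a y by (auto intro!: imageI subring_intros)
  \<comment> \<open>The map \<open>y \<mapsto> y ^ q\<close> is the identity modulo
    \<open>l\<close>, hence so are its iterates. For \<open>j = d\<close> the exponent is at least
    \<open>d\<close>, so \<open>y\<close> is congruent to a multiple of \<open>y ^ d\<close>, that
    is, to \<open>0\<close>.\<close>
  have "y ^ (q ^ j) - y \<in> (*) l ` R" for j
  proof (induction j)
    case 0
    then show ?case by (simp add: multiple_zero)
  next
    case (Suc j)
    have "(y ^ (q ^ j)) ^ q - y ^ q \<in> (*) l ` R"
      by (intro multiple_power_diff Suc subring_intros y)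
    then have "((y ^ (q ^ j)) ^ q - y ^ q) + (y ^ q - y) \<in> (*) l ` R"
      by (intro multiple_add q y)
    then show ?case
      by (simp add: power_mult [symmetric] mult.commute)
  qed
  moreover have "y ^ (q ^ d) \<in> (*) l ` R"
  proof -
    have "d \<le> q ^ d"
      using assms(5) self_le_ge2_pow[of q d] by simp
    then have "y ^ (q ^ d) = y ^ d * y ^ (q ^ d - d)"
      by (simp flip: power_add)
    then show ?thesis
      using yd y by (auto intro!: multiple_mult subring_intros)
  qed
  ultimately have "y \<in> (*) l ` R"
    using multiple_diff[of "y ^ (q ^ d)" l "y ^ (q ^ d) - y"] by simp
  then show ?thesis
    using assms(2) unfolding y_def by (metis imageE mult_left_cancel)
qed

lemma integral_over_cancel_power:
  assumes "l \<in> R" "l \<noteq> 0" "integral_over x" "l ^ k * x \<in> R" "q > 1"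
    and q: "\<And>y. y \<in> R \<Longrightarrow> y ^ q - y \<in> (*) l ` R"
  shows "x \<in> R"
  using assms(3,4)
proof (induction k arbitrary: x)
  case (Suc k)
  have "l * x \<in> R"
    by (rule Suc.IH[OF integral_over_mult[OF Suc.prems(1) assms(1)]])
      (use Suc.prems(2) in \<open>simp only: power_Suc2 mult.assoc\<close>)
  then show ?case
    by (rule integral_over_cancel[OF assms(1,2) Suc.prems(1) _ assms(5) q])
qed simp

end

lemma integral_over_of_algebraic_int:
  assumes "is_subring R" "algebraic_int x"
  shows "integral_over R x"
proof -
  obtain p where p: "lead_coeff p = 1" "\<And>i. coeff p i \<in> \<int>" "poly p x = 0"
    using assms(2) by (auto simp: algebraic_int.simps)
  have "x ^ degree p = - (\<Sum>i<degree p. coeff p i * x ^ i)"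
    using p(1,3) by (simp add: poly_altdef lessThan_Suc_atMost [symmetric] add_eq_0_iff2)
  then have "x ^ degree p = (\<Sum>i<degree p. - coeff p i * x ^ i)"
    by (simp add: sum_negf)
  moreover have "- coeff p i \<in> R" for i
    using p(2)[of i] subring_of_int[OF assms(1)] subring_minus[OF assms(1)] by (auto elim!: Ints_cases)
  ultimately show ?thesis
    unfolding integral_over_def[OF assms(1)]
    by (intro exI[of _ "degree p"] exI[of _ "\<lambda>i. - coeff p i"]) simp
qed

section \<open>The ring of integers of a cyclotomic field\<close>

lemma is_subfield_imp_subring: "is_subfield F \<Longrightarrow> is_subring F"
  unfolding is_subfield_def is_subring_def by (metis diff_conv_add_uminus)

lemma is_subfield_adjoin: "is_subfield (adjoin F x)"
  unfolding adjoin_def by (rule hull_in) (auto simp: is_subfield_def)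

lemma adjoin_subset: "is_subfield E \<Longrightarrow> x \<in> E \<Longrightarrow> F \<subseteq> E \<Longrightarrow> adjoin F x \<subseteq> E"
  unfolding adjoin_def by (rule hull_minimal) auto

lemma adjoin_gen: "x \<in> adjoin F x"
  using hull_subset[of "insert x F" is_subfield] by (auto simp: adjoin_def)

lemma subring_poly:
  assumes "is_subring R" "x \<in> R"
  shows "poly (map_poly of_int p) x \<in> R"
proof -
  have "poly (map_poly of_int p) x = (\<Sum>i\<le>degree (map_poly of_int p :: 'a poly). of_int (coeff p i) * x ^ i)"
    by (simp add: poly_altdef coeff_map_poly)
  then show ?thesis
    using assms by (simp add: subring_intros)
qed

locale cyclotomic =
  fixes n :: nat and \<eta> :: "'a::field_char_0"
  assumes primitive: "primitive_root_of_unity n \<eta>"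
begin

lemma n_pos: "n > 0" and eta_power_n: "\<eta> ^ n = 1"
  and eta_power_neq_1: "0 < k \<Longrightarrow> k < n \<Longrightarrow> \<eta> ^ k \<noteq> 1"
  using primitive by (auto simp: primitive_root_of_unity_def)

definition Z :: "'a set" where
  "Z = range (\<lambda>p. poly (map_poly of_int p) \<eta>)"

lemma Z_subring: "is_subring Z"
  unfolding is_subring_def
proof (intro conjI ballI)
  have "poly (map_poly of_int 1) \<eta> = 1"
    by simp
  then show "1 \<in> Z"
    unfolding Z_def by (metis rangeI)
next
  fix x y assume "x \<in> Z" "y \<in> Z"
  then obtain p q where "x = poly (map_poly of_int p) \<eta>" "y = poly (map_poly of_int q) \<eta>"
    by (auto simp: Z_def)
  then have "x - y = poly (map_poly of_int (p - q)) \<eta>" "x * y = poly (map_poly of_int (p * q)) \<eta>"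
    by (simp_all add: hom_distribs)
  then show "x - y \<in> Z" "x * y \<in> Z"
    by (auto simp: Z_def)
qed

lemmas Z_intros = subring_intros[OF Z_subring]

lemma eta_in_Z: "\<eta> \<in> Z"
proof -
  have "\<eta> = poly (map_poly of_int [:0, 1:]) \<eta>"
    by simp
  then show ?thesis
    unfolding Z_def by blast
qed

text \<open>This is the Horner scheme of an integer polynomial at \<open>\<eta>\<close>: a property
  only has to survive the passage from \<open>y\<close> to \<open>c + \<eta> * y\<close>.\<close>

lemma Z_induct [consumes 1, case_names zero step]:
  assumes "x \<in> Z" "P 0" "\<And>c y. y \<in> Z \<Longrightarrow> P y \<Longrightarrow> P (of_int c + \<eta> * y)"
  shows "P x"
proof -
  have "P (poly (map_poly of_int p) \<eta>)" for p
  proof (induction p)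
    case 0
    then show ?case using assms(2) by simp
  next
    case (pCons a p)
    then show ?case
      using assms(3)[of "poly (map_poly of_int p) \<eta>" a] by (simp add: Z_def map_poly_pCons)
  qed
  then show ?thesis
    using assms(1) by (auto simp: Z_def)
qed

text \<open>The powers below \<open>n\<close> span but are in general linearly dependent, so
  coefficients are chosen and not unique.\<close>

lemma Z_coefficients:
  assumes "x \<in> Z"
  shows "\<exists>c. x = (\<Sum>i<n. of_int (c i) * \<eta> ^ i)"
  using assms
proof (induction rule: Z_induct)
  case zero
  then show ?case by (intro exI[of _ "\<lambda>_. 0"]) simp
next
  case (step a y)
  obtain c where c: "y = (\<Sum>i<n. of_int (c i) * \<eta> ^ i)"
    using step.IH by blast
  obtain m where m: "n = Suc m"
    using n_pos gr0_implies_Suc by blast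
  \<comment> \<open>Multiplication by \<open>\<eta>\<close> shifts the coefficients cyclically: the
    last one, \<open>c m\<close>, belongs to \<open>\<eta> ^ n = 1\<close> and returns to position
    \<open>0\<close>.\<close>
  define d where "d i = (case i of 0 \<Rightarrow> a + c m | Suc j \<Rightarrow> c j)" for i
  have "\<eta> * y = (\<Sum>i<n. of_int (c i) * \<eta> ^ Suc i)"
    unfolding c sum_distrib_left by (simp add: mult_ac)
  also have "\<dots> = (\<Sum>i<m. of_int (c i) * \<eta> ^ Suc i) + of_int (c m) * \<eta> ^ n"
    unfolding m by simp
  also have "\<dots> = (\<Sum>i<m. of_int (c i) * \<eta> ^ Suc i) + of_int (c m)"
    by (simp add: eta_power_n)
  finally have "of_int a + \<eta> * y = (\<Sum>i<n. of_int (d i) * \<eta> ^ i)"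
    unfolding m sum.lessThan_Suc_shift by (simp add: d_def)
  then show ?case
    by blast
qed

text \<open>Multiplication by \<open>y\<close> acts on the vector of powers of \<open>\<eta>\<close>
  through an integer matrix; its entry \<open>\<eta> ^ 0 = 1\<close> shows that the vector is
  nonzero.\<close>

lemma Z_algebraic_int:
  assumes "y \<in> Z"
  shows "algebraic_int y"
proof -
  have "\<exists>c. y * \<eta> ^ i = (\<Sum>j<n. of_int (c j) * \<eta> ^ j)" for i
    by (intro Z_coefficients Z_intros assms eta_in_Z)
  then obtain M where "\<And>i. y * \<eta> ^ i = (\<Sum>j<n. of_int (M i j) * \<eta> ^ j)"
    by metis
  then show ?thesis
    using n_pos by (intro algebraic_int_if_integer_eigenvector[of 0 n "\<lambda>i. \<eta> ^ i"]) auto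
qed

text \<open>\<open>h\<close> reduces the chosen coefficients modulo \<open>N\<close>. It may take
  different values on congruent elements, but a finite image and the implication from equal values
  to congruence are what pigeonhole arguments use.\<close>

lemma Z_finite_quotient:
  assumes "N > 0"
  shows "\<exists>h :: 'a \<Rightarrow> 'a. finite (h ` Z) \<and> (\<forall>x\<in>Z. \<forall>y\<in>Z. h x = h y \<longrightarrow> x - y \<in> (*) (of_nat N) ` Z)"
proof -
  obtain c where c: "\<And>x. x \<in> Z \<Longrightarrow> x = (\<Sum>i<n. of_int (c x i) * \<eta> ^ i)"
    using Z_coefficients by metis
  define h where "h x = (\<Sum>i<n. of_int (c x i mod int N) * \<eta> ^ i)" for x
  have h: "x - h x \<in> (*) (of_nat N) ` Z" if x: "x \<in> Z" for x
  proof -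
    have "x - h x = (\<Sum>i<n. of_int (c x i - c x i mod int N) * \<eta> ^ i)"
      by (subst c[OF x]) (simp add: h_def sum_subtractf algebra_simps)
    also have "\<dots> = (\<Sum>i<n. of_nat N * (of_int (c x i div int N) * \<eta> ^ i))"
    proof (rule sum.cong)
      fix i
      have "c x i - c x i mod int N = int N * (c x i div int N)"
        by (simp add: minus_mod_eq_mult_div)
      then show "of_int (c x i - c x i mod int N) * \<eta> ^ i = of_nat N * (of_int (c x i div int N) * \<eta> ^ i)"
        by (simp del: of_int_diff)
    qed simp
    finally have "x - h x = of_nat N * (\<Sum>i<n. of_int (c x i div int N) * \<eta> ^ i)"
      by (simp add: sum_distrib_left)
    then show ?thesis
      by (auto intro!: Z_intros eta_in_Z)
  qed
  have hx: "h x \<in> (\<lambda>f. \<Sum>i<n. of_int (f i) * \<eta> ^ i) ` PiE {..<n} (\<lambda>_. {0..<int N})" (is "_ \<in> ?A") for x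
  proof
    show "h x = (\<Sum>i<n. of_int (restrict (\<lambda>i. c x i mod int N) {..<n} i) * \<eta> ^ i)"
      by (simp add: h_def)
    show "restrict (\<lambda>i. c x i mod int N) {..<n} \<in> PiE {..<n} (\<lambda>_. {0..<int N})"
      using assms by auto
  qed
  have "finite ?A"
    by (intro finite_imageI finite_PiE) auto
  then have "finite (h ` Z)"
    by (rule rev_finite_subset) (use hx in blast)
  moreover have "x - y \<in> (*) (of_nat N) ` Z" if "x \<in> Z" "y \<in> Z" "h x = h y" for x y
    using multiple_diff[OF Z_subring h[OF that(1)] h[OF that(2)]] that(3) by simp
  ultimately show ?thesis
    by blast
qed

text \<open>Modulo \<open>l\<close> the \<open>q\<close>-th power map is additive and
  multiplicative. It fixes the integers by Fermat and \<open>\<eta>\<close> by hypothesis, hence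
  everything by the Horner induction.\<close>

lemma Z_frobenius:
  assumes p: "prime p" "of_nat p \<in> (*) l ` Z" and q: "q = p ^ r" and eta: "\<eta> ^ q - \<eta> \<in> (*) l ` Z"
    and "y \<in> Z"
  shows "y ^ q - y \<in> (*) l ` Z"
  using \<open>y \<in> Z\<close>
proof (induction rule: Z_induct)
  case zero
  then show ?case
    using p(1) by (simp add: q multiple_zero[OF Z_subring] prime_gt_0_nat power_0_left)
next
  case (step c y)
  have int: "of_int c ^ q - of_int c \<in> (*) l ` Z" for c :: int
  proof -
    have nat: "of_nat k ^ q - of_nat k \<in> (*) l ` Z" for k
    proof (induction k)
      case 0
      then show ?case
        using p(1) by (simp add: q multiple_zero[OF Z_subring] prime_gt_0_nat power_0_left)
    next
      case (Suc k)
      have "(1 + of_nat k) ^ q - (1 ^ q + of_nat k ^ q) \<in> (*) l ` Z"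
        unfolding q by (intro add_power_prime_power_multiple[OF Z_subring] p Z_intros)
      from multiple_add[OF Z_subring this Suc]
      have "(1 + of_nat k) ^ q - 1 - of_nat k \<in> (*) l ` Z"
        by (simp add: algebra_simps)
      then show ?case
        by (simp add: diff_diff_eq)
    qed
    \<comment> \<open>An arbitrary integer is congruent modulo \<open>l\<close> to its natural
      residue modulo \<open>p\<close>, for which the claim was proved by induction.\<close>
    define k where "k = nat (c mod int p)"
    have "c - int k = int p * (c div int p)"
      using p(1) prime_gt_0_nat[of p] by (simp add: k_def minus_mod_eq_mult_div)
    then have "of_int c - of_nat k = (of_nat p * of_int (c div int p) :: 'a)"
      by (metis of_int_diff of_int_mult of_int_of_nat_eq)
    then have *: "of_int c - of_nat k \<in> (*) l ` Z"
      using p(2) multiple_mult[OF Z_subring] Z_intros(11) by metis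
    have "of_int c ^ q - of_nat k ^ q \<in> (*) l ` Z"
      by (intro multiple_power_diff[OF Z_subring] Z_intros *)
    from multiple_diff[OF Z_subring multiple_add[OF Z_subring this nat[of k]] *]
    show ?thesis
      by simp
  qed
  have 1: "(of_int c + \<eta> * y) ^ q - (of_int c ^ q + (\<eta> * y) ^ q) \<in> (*) l ` Z"
    unfolding q by (intro add_power_prime_power_multiple[OF Z_subring] p Z_intros eta_in_Z step)
  have 2: "(y ^ q - y) * \<eta> ^ q + (\<eta> ^ q - \<eta>) * y \<in> (*) l ` Z"
    by (intro multiple_add[OF Z_subring] multiple_mult[OF Z_subring] step eta Z_intros eta_in_Z)
  from multiple_add[OF Z_subring 1 multiple_add[OF Z_subring 2 int[of c]]]
  show ?case
    by (simp add: algebra_simps power_mult_distrib)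
qed

text \<open>If \<open>n = p ^ e * m\<close> with \<open>p\<close> not dividing \<open>m\<close>, then \<open>Z\<close> is reduced modulo \<open>p\<close> for \<open>e = 0\<close>
  and modulo \<open>1 - \<eta> ^ m\<close> otherwise; in the latter case \<open>p\<close> divides a power of \<open>1 - \<eta> ^ m\<close>.\<close>

lemma integral_over_Z_cancel_prime:
  assumes p: "prime p" and x: "integral_over Z x" "of_nat p * x \<in> Z"
  shows "x \<in> Z"
proof -
  obtain e m where n: "n = m * p ^ e" and pm: "\<not> p dvd m"
    using prime_power_canonical[OF p] n_pos by blast
  have m: "m > 0"
    using n n_pos by (cases m) auto
  \<comment> \<open>By Euler this power of \<open>p\<close> is \<open>1\<close> modulo
    \<open>m\<close>, so with \<open>q = m * t + 1\<close> one has
    \<open>\<eta> ^ q = \<eta> * (\<eta> ^ m) ^ t\<close>. For \<open>e = 0\<close> this is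
    \<open>\<eta>\<close>, otherwise it is congruent to \<open>\<eta>\<close> modulo
    \<open>1 - \<eta> ^ m\<close>.\<close>
  define q where "q = p ^ totient m"
  have q1: "q > 1"
    using p m unfolding q_def by (intro one_less_power) (auto dest: prime_gt_1_nat)
  have "[q = 1] (mod m)"
    unfolding q_def using p pm m
    by (intro euler_theorem) (simp add: prime_imp_coprime)
  then have "m dvd q - 1"
    using q1 cong_to_1_nat by simp
  then obtain t where "q - 1 = m * t"
    by blast
  then have q: "q = Suc (m * t)"
    using q1 by simp
  show ?thesis
  proof (cases "e = 0")
    case True
    then have "\<eta> ^ q - \<eta> \<in> (*) (of_nat p) ` Z"
      using n eta_power_n by (simp add: q power_mult multiple_zero[OF Z_subring])
    moreover have "of_nat p \<in> (*) (of_nat p) ` Z"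
      using Z_intros(1) by force
    ultimately show ?thesis
      using p x q1 Z_frobenius[OF p _ q_def]
      by (intro integral_over_cancel[OF Z_subring, of "of_nat p" x q]) (auto intro: Z_intros)
  next
    case False
    define z where "z = \<eta> ^ m"
    define l where "l = 1 - z"
    have z: "z \<in> Z"
      unfolding z_def by (intro Z_intros eta_in_Z)
    have l: "l \<in> Z"
      unfolding l_def by (intro Z_intros z)
    have pe: "p ^ e > 1"
      using p False by (intro one_less_power) (auto dest: prime_gt_1_nat)
    have zpe: "z ^ (p ^ e) = 1"
      using n eta_power_n by (simp add: z_def flip: power_mult)
    have l0: "l \<noteq> 0"
      using eta_power_neq_1[of m] m pe n by (simp add: l_def z_def)
    have zpow: "1 - z ^ k \<in> (*) l ` Z" for k
    proof -
      have "1 - z \<in> (*) l ` Z"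
        using Z_intros(1) by (force simp: l_def)
      then have "1 ^ k - z ^ k \<in> (*) l ` Z"
        by (intro multiple_power_diff[OF Z_subring] Z_intros z)
      then show ?thesis
        by simp
    qed
    have pl: "of_nat p \<in> (*) l ` Z"
    proof -
      \<comment> \<open>\<open>w\<close> is a nontrivial \<open>p\<close>-th root of unity, so its
        powers sum to \<open>0\<close> and \<open>p\<close> is the sum of the
        \<open>1 - w ^ i\<close>, each divisible by \<open>1 - z\<close>.\<close>
      define w where "w = z ^ (p ^ (e - 1))"
      have "w \<noteq> 1"
      proof -
        have "p ^ e = p * p ^ (e - 1)"
          using False by (simp flip: power_Suc)
        moreover have "p ^ (e - 1) > 0" "p > 1"
          using p prime_gt_1_nat[of p] by auto
        ultimately have "0 < p ^ (e - 1)" "p ^ (e - 1) < p ^ e"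
          by auto
        then show ?thesis
          using eta_power_neq_1[of "m * p ^ (e - 1)"] m n by (simp add: w_def z_def power_mult)
      qed
      moreover have "w ^ p = 1"
        using zpe False by (simp add: w_def flip: power_mult power_Suc2)
      ultimately have "(\<Sum>i<p. w ^ i) = 0"
        by (simp add: sum_gp_strict)
      then have "of_nat p = (\<Sum>i<p. 1 - w ^ i)"
        by (simp add: sum_subtractf)
      moreover have "(\<Sum>i<k. 1 - w ^ i) \<in> (*) l ` Z" for k
        by (induction k) (auto intro: multiple_add[OF Z_subring] multiple_zero[OF Z_subring] zpow
            simp: w_def simp flip: power_mult)
      ultimately show ?thesis
        by metis
    qed
    have "1 - z ^ t \<in> (*) l ` Z"
      by (rule zpow)
    then have "(1 - z ^ t) * (- \<eta>) \<in> (*) l ` Z"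
      by (intro multiple_mult[OF Z_subring] Z_intros eta_in_Z)
    then have "\<eta> ^ q - \<eta> \<in> (*) l ` Z"
      by (simp add: q z_def power_mult algebra_simps)
    note frob = Z_frobenius[OF p pl q_def this]
    \<comment> \<open>Modulo \<open>p\<close> the power \<open>(1 - z) ^ (p ^ e)\<close> is
      \<open>1 + (- z) ^ (p ^ e)\<close>, which is \<open>0\<close> for odd \<open>p\<close> and
      \<open>2\<close> for \<open>p = 2\<close>, as \<open>z ^ (p ^ e) = 1\<close>.\<close>
    have "(1 + - z) ^ (p ^ e) - (1 ^ (p ^ e) + (- z) ^ (p ^ e)) \<in> (*) (of_nat p) ` Z"
      using Z_intros(1)
      by (intro add_power_prime_power_multiple[OF Z_subring] p Z_intros z) force
    moreover have "1 ^ (p ^ e) + (- z) ^ (p ^ e) \<in> (*) (of_nat p) ` Z"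
    proof (cases "p = 2")
      case True
      then have "1 ^ (p ^ e) + (- z) ^ (p ^ e) = of_nat p * 1"
        using zpe False by (simp add: power_minus_even)
      then show ?thesis
        using Z_intros(1) by blast
    next
      case F: False
      then have "odd (p ^ e)"
        using p F prime_odd_nat[of p] prime_ge_2_nat[of p] by auto
      then show ?thesis
        using zpe multiple_zero[OF Z_subring] by (simp add: power_minus_odd)
    qed
    ultimately have "(1 + - z) ^ (p ^ e) - (1 ^ (p ^ e) + (- z) ^ (p ^ e)) + (1 ^ (p ^ e) + (- z) ^ (p ^ e))
        \<in> (*) (of_nat p) ` Z"
      by (rule multiple_add[OF Z_subring])
    then have "l ^ (p ^ e) \<in> (*) (of_nat p) ` Z"
      by (simp add: l_def)
    then obtain c where c: "c \<in> Z" "l ^ (p ^ e) = of_nat p * c"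
      by blast
    then have "l ^ (p ^ e) * x \<in> Z"
      using Z_intros(6)[OF c(1) x(2)] by (simp add: mult_ac)
    then show ?thesis
      by (rule integral_over_cancel_power[OF Z_subring l l0 x(1) _ q1 frob])
  qed
qed

lemma integral_over_Z_cancel_nat:
  assumes "k > 0" "integral_over Z x" "of_nat k * x \<in> Z"
  shows "x \<in> Z"
  using assms
proof (induction k arbitrary: x rule: prime_divisors_induct)
  case (factor p k)
  have "integral_over Z (of_nat k * x)"
    by (rule integral_over_mult[OF Z_subring factor.prems(2)]) (rule Z_intros)
  moreover have "of_nat p * (of_nat k * x) \<in> Z"
    using factor.prems(3) by (simp add: mult.assoc)
  ultimately have "of_nat k * x \<in> Z"
    by (rule integral_over_Z_cancel_prime[OF factor.hyps])
  with factor.prems show ?case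
    by (intro factor.IH[OF _ factor.prems(2)]) auto
qed auto

text \<open>A nonzero \<open>z\<close> divides the constant coefficient of an integer polynomial
  that vanishes at \<open>z\<close>; factors of the variable are cancelled first to make this
  coefficient nonzero.\<close>

lemma Z_multiple_nat:
  assumes "z \<in> Z" "z \<noteq> 0"
  shows "\<exists>k>0. of_nat k / z \<in> Z"
proof -
  have *: "\<exists>a w. a \<noteq> 0 \<and> w \<in> Z \<and> of_int a = z * w"
    if "poly (map_poly of_int p) z = 0" "p \<noteq> 0" for p :: "int poly"
    using that
  proof (induction p)
    case (pCons a p)
    let ?w = "poly (map_poly of_int p) z"
    have w: "?w \<in> Z"
      by (rule subring_poly[OF Z_subring assms(1)])
    have eq: "of_int a + z * ?w = 0"
      using pCons.prems by (simp add: map_poly_pCons)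
    show ?case
    proof (cases "a = 0")
      case True
      then show ?thesis
        using pCons eq assms(2) by auto
    next
      case False
      then show ?thesis
        using eq w Z_intros(3)
        by (intro exI[of _ a] exI[of _ "- ?w"]) (auto simp: eq_neg_iff_add_eq_0)
    qed
  qed simp
  obtain p where "poly (map_poly of_int p) z = 0" "lead_coeff p = 1"
    using Z_algebraic_int[OF assms(1)] unfolding algebraic_int_altdef_ipoly by blast
  then obtain a w where a: "a \<noteq> 0" "w \<in> Z" "of_int a = z * w"
    using *[of p] by force
  have "of_nat (nat \<bar>a\<bar>) / z = of_int (sgn a) * w"
    using a(1,3) assms(2) by (cases "a > 0") (auto simp: field_simps)
  then show ?thesis
    using a by (intro exI[of _ "nat \<bar>a\<bar>"]) (auto intro: Z_intros)
qed

text \<open>The elements with a natural number as denominator form a subfield, with inverses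
  supplied by \<open>Z_multiple_nat\<close>, so they contain everything generated by
  \<open>\<eta>\<close>.\<close>

lemma field_multiple_nat:
  assumes "x \<in> adjoin \<rat> \<eta>"
  shows "\<exists>k>0. of_nat k * x \<in> Z"
proof -
  define S where "S = {x. \<exists>k>0. of_nat k * x \<in> Z}"
  have Zsub: "Z \<subseteq> S"
    by (auto simp: S_def intro!: exI[of _ 1])
  have "is_subfield S"
    unfolding is_subfield_def
  proof (intro conjI ballI)
    show "0 \<in> S" "1 \<in> S"
      using Zsub Z_intros by auto
  next
    fix x y assume "x \<in> S" "y \<in> S"
    then obtain k j where kj: "k > 0" "j > 0" "of_nat k * x \<in> Z" "of_nat j * y \<in> Z"
      by (auto simp: S_def)
    have "of_nat (k * j) * (x + y) = of_nat j * (of_nat k * x) + of_nat k * (of_nat j * y)"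
      by (simp add: algebra_simps)
    then show "x + y \<in> S"
      unfolding S_def using kj by (intro CollectI exI[of _ "k * j"]) (simp add: Z_intros)
    have "of_nat (k * j) * (x * y) = (of_nat k * x) * (of_nat j * y)"
      by simp
    also have "\<dots> \<in> Z"
      by (rule Z_intros(6)[OF kj(3,4)])
    finally show "x * y \<in> S"
      unfolding S_def using kj by (intro CollectI exI[of _ "k * j"]) simp
  next
    fix x assume "x \<in> S"
    then obtain k where k: "k > 0" "of_nat k * x \<in> Z"
      by (auto simp: S_def)
    have "of_nat k * - x \<in> Z"
      using Z_intros(3)[OF k(2)] by simp
    then show "- x \<in> S"
      unfolding S_def using k by blast
    show "inverse x \<in> S"
    proof (cases "x = 0")
      case True
      then show ?thesis using Zsub Z_intros(2) by auto
    next
      case False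
      then obtain j where j: "j > 0" "of_nat j / (of_nat k * x) \<in> Z"
        using Z_multiple_nat[OF k(2)] k(1) by auto
      have "of_nat j * inverse x = of_nat k * (of_nat j / (of_nat k * x))"
        using k False by (simp add: field_simps)
      also have "\<dots> \<in> Z"
        using j by (intro Z_intros)
      finally show ?thesis
        using j by (auto simp: S_def)
    qed
  qed
  moreover have "\<rat> \<subseteq> S"
  proof
    fix x :: 'a assume "x \<in> \<rat>"
    then obtain a b where "b > 0" "x = of_int a / of_int b"
      by (metis Rats_cases')
    then have "of_nat (nat b) * x = of_int a"
      by simp
    then show "x \<in> S"
      using \<open>b > 0\<close> unfolding S_def
      by (intro CollectI exI[of _ "nat b"]) (auto intro: Z_intros)
  qed
  moreover have "\<eta> \<in> S"
    using Zsub eta_in_Z by auto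
  ultimately have "adjoin \<rat> \<eta> \<subseteq> S"
    by (intro adjoin_subset)
  then show ?thesis
    using assms by (auto simp: S_def)
qed

lemma Z_subset_field: "Z \<subseteq> adjoin \<rat> \<eta>"
  unfolding Z_def
  using subring_poly[OF is_subfield_imp_subring[OF is_subfield_adjoin] adjoin_gen] by auto

lemma integral_over_Z:
  assumes "x \<in> adjoin \<rat> \<eta>" "integral_over Z x"
  shows "x \<in> Z"
  using assms field_multiple_nat integral_over_Z_cancel_nat by blast

theorem ring_of_integers_eq_Z: "ring_of_integers (adjoin \<rat> \<eta>) = Z"
  using integral_over_Z integral_over_of_algebraic_int[OF Z_subring] Z_subset_field Z_algebraic_int
  by (auto simp: ring_of_integers_def)

end

section \<open>Fractional ideals in rings with finite quotients\<close>

lemma is_submodule_zero: "is_submodule R M \<Longrightarrow> 0 \<in> M"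
  and is_submodule_add: "is_submodule R M \<Longrightarrow> x \<in> M \<Longrightarrow> y \<in> M \<Longrightarrow> x + y \<in> M"
  and is_submodule_scale: "is_submodule R M \<Longrightarrow> r \<in> R \<Longrightarrow> x \<in> M \<Longrightarrow> r * x \<in> M"
  by (auto simp: is_submodule_def)

lemma is_submodule_minus: "is_subring R \<Longrightarrow> is_submodule R M \<Longrightarrow> x \<in> M \<Longrightarrow> - x \<in> M"
  using is_submodule_scale[of R M "- 1" x] subring_minus[OF _ subring_one] by force

lemma is_submodule_diff:
  "is_subring R \<Longrightarrow> is_submodule R M \<Longrightarrow> x \<in> M \<Longrightarrow> y \<in> M \<Longrightarrow> x - y \<in> M"
  using is_submodule_add[of R M x "- y"] is_submodule_minus[of R M y] by simp

text \<open>The last assumption is the only form of integral closedness that is needed: by finiteness of the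
  quotients, a multiplier \<open>y\<close> of a fractional ideal satisfies \<open>y ^ j - y ^ i \<in> R\<close> for some \<open>i < j\<close>.\<close>

locale number_ring =
  fixes F R :: "'a::field_char_0 set"
  assumes field: "is_subfield F" and ring: "is_subring R" and ring_subset: "R \<subseteq> F"
    and denominator: "\<And>x. x \<in> F \<Longrightarrow> \<exists>k>0. of_nat k * x \<in> R"
    and finite_quotient: "\<And>N. N > 0 \<Longrightarrow>
      \<exists>h :: 'a \<Rightarrow> 'a. finite (h ` R) \<and> (\<forall>x\<in>R. \<forall>y\<in>R. h x = h y \<longrightarrow> x - y \<in> (*) (of_nat N) ` R)"
    and root_closed: "\<And>x i j. x \<in> F \<Longrightarrow> i < j \<Longrightarrow> x ^ j - x ^ i \<in> R \<Longrightarrow> x \<in> R"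
begin

lemmas R_intros = subring_intros[OF ring]
lemmas R_mult = R_intros(6)

lemma F_subring: "is_subring F"
  by (rule is_subfield_imp_subring[OF field])

lemmas F_intros = subring_intros[OF F_subring]

lemma F_inverse: "x \<in> F \<Longrightarrow> inverse x \<in> F"
  using field by (auto simp: is_subfield_def)

lemma F_divide: "x \<in> F \<Longrightarrow> y \<in> F \<Longrightarrow> x / y \<in> F"
  unfolding divide_inverse by (intro F_intros F_inverse)

lemma R_F: "x \<in> R \<Longrightarrow> x \<in> F"
  using ring_subset by auto

section \<open>Pigeonhole arguments in finite quotients\<close>

lemma pigeonhole_mod:
  fixes f :: "nat \<Rightarrow> 'a"
  assumes "N > 0" "\<And>k. f k \<in> R"
  shows "\<exists>i j. i < j \<and> f j - f i \<in> (*) (of_nat N) ` R"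
proof -
  obtain h :: "'a \<Rightarrow> 'a" where h: "finite (h ` R)"
    "\<And>x y. x \<in> R \<Longrightarrow> y \<in> R \<Longrightarrow> h x = h y \<Longrightarrow> x - y \<in> (*) (of_nat N) ` R"
    using finite_quotient[OF assms(1)] by metis
  have "finite (range (\<lambda>k::nat. h (f k)))"
    by (rule finite_subset[OF _ h(1)]) (use assms(2) in auto)
  then have "\<not> inj (\<lambda>k. h (f k))"
    using finite_imageD by blast
  then obtain i j where "i \<noteq> j" "h (f i) = h (f j)"
    unfolding inj_on_def by blast
  then show ?thesis
    using h(2)[of "f i" "f j"] h(2)[of "f j" "f i"] assms(2) by (metis linorder_neqE_nat)
qed

text \<open>All powers of \<open>y\<close> share a denominator \<open>N\<close>. Pigeonhole is
  applied to \<open>N * y ^ k\<close>, which lies in \<open>R\<close>; dividing the congruence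
  modulo \<open>N\<close> by \<open>N\<close> leaves \<open>y ^ j - y ^ i \<in> R\<close>.\<close>

lemma stable_imp_mem:
  assumes y: "y \<in> F" and M: "m \<in> M" "m \<noteq> 0" "\<And>x. x \<in> M \<Longrightarrow> y * x \<in> M"
    and d: "d \<noteq> 0" "\<And>x. x \<in> M \<Longrightarrow> d * x \<in> R"
  shows "y \<in> R"
proof -
  have "y ^ k * m \<in> M" for k
    using M by (induction k) (auto simp: mult.assoc)
  then have dym: "d * (y ^ k * m) \<in> R" for k
    using d(2) by blast
  have "d * m \<in> F"
    using dym[of 0] R_F by simp
  then obtain N where N: "N > 0" "of_nat N * inverse (d * m) \<in> R"
    using denominator[OF F_inverse] by blast
  have "of_nat N * y ^ k = of_nat N * inverse (d * m) * (d * (y ^ k * m))" for k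
    using M(2) d(1) by (simp add: field_simps)
  then have "of_nat N * y ^ k \<in> R" for k
    using R_mult[OF N(2) dym] by metis
  then obtain i j where ij: "i < j" "of_nat N * y ^ j - of_nat N * y ^ i \<in> (*) (of_nat N) ` R"
    using pigeonhole_mod[OF N(1), of "\<lambda>k. of_nat N * y ^ k"] by blast
  then have "y ^ j - y ^ i \<in> R"
    using N(1) by (auto simp flip: right_diff_distrib)
  then show ?thesis
    using root_closed y ij(1) by blast
qed

text \<open>Powers are eventually periodic modulo \<open>N\<close>: \<open>x ^ (a + m)\<close>
  agrees with \<open>x ^ a\<close>. The exponent \<open>m * a\<close> is a multiple of the period
  beyond the start of periodicity, so its power is idempotent. Counting from \<open>Suc\<close>
  keeps \<open>a\<close>, and thus this exponent, positive.\<close>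

lemma idempotent_power:
  assumes "N > 0" "x \<in> R"
  shows "\<exists>k>0. x ^ k * x ^ k - x ^ k \<in> (*) (of_nat N) ` R"
proof -
  obtain i j where ij: "i < j" "x ^ Suc j - x ^ Suc i \<in> (*) (of_nat N) ` R"
    using pigeonhole_mod[OF assms(1), of "\<lambda>k. x ^ Suc k"] assms(2) R_intros(7) by metis
  define m where "m = j - i"
  define a where "a = Suc i"
  have 1: "x ^ a * (x ^ m - 1) \<in> (*) (of_nat N) ` R"
    using ij by (simp add: a_def m_def algebra_simps flip: power_Suc power_add)
  have "x ^ m - 1 \<in> (*) (x ^ m - 1) ` R"
    using R_intros(1) by force
  then have "(x ^ m) ^ a - 1 ^ a \<in> (*) (x ^ m - 1) ` R"
    using assms(2) by (intro multiple_power_diff[OF ring] R_intros)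
  then obtain s where s: "s \<in> R" "x ^ (m * a) - 1 = (x ^ m - 1) * s"
    by (auto simp flip: power_mult)
  have "m > 0"
    using ij by (simp add: m_def)
  then have "a \<le> m * a"
    by simp
  then have "x ^ (m * a) = x ^ a * x ^ (m * a - a)"
    by (simp flip: power_add)
  then have "x ^ (m * a) * (x ^ (m * a) - 1) = x ^ a * (x ^ m - 1) * (s * x ^ (m * a - a))"
    using s(2) by simp
  also have "\<dots> \<in> (*) (of_nat N) ` R"
    using s(1) assms(2) by (intro multiple_mult[OF ring 1] R_intros)
  finally show ?thesis
    using \<open>m > 0\<close> by (intro exI[of _ "m * a"]) (simp add: a_def algebra_simps)
qed

text \<open>Equivalently, a proper ideal of the finite ring \<open>R/N\<close> has a nonzero annihilator. The set \<open>S\<close>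
  consists of the elements that are not killed by the localisation of \<open>R/N\<close> at \<open>1 + J\<close>.\<close>

lemma one_mem_ideal:
  assumes J: "J \<subseteq> R" "is_submodule R J" and N: "N > 0" "of_nat N \<in> J"
    and inv: "\<And>y. y \<in> F \<Longrightarrow> (\<And>x. x \<in> J \<Longrightarrow> y * x \<in> R) \<Longrightarrow> y \<in> R"
  shows "1 \<in> J"
proof (rule ccontr)
  assume 1: "1 \<notin> J"
  define I where "I = (*) (of_nat N) ` R"
  note I_intros = multiple_zero[OF ring, of "of_nat N", folded I_def]
    multiple_add[OF ring, of _ "of_nat N", folded I_def]
    multiple_mult[OF ring, of _ "of_nat N", folded I_def]
  have IJ: "I \<subseteq> J"
    using is_submodule_scale[OF J(2) _ N(2)] by (auto simp: I_def mult.commute)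
  define S where "S = {z \<in> R. \<forall>j\<in>J. (1 - j) * z \<notin> I}"
  have 1: "1 \<in> S"
    using 1 IJ is_submodule_add[OF J(2)] R_intros(1) unfolding S_def by fastforce
  have annihilator: "\<exists>z\<in>S. \<forall>g\<in>G. z * g \<in> I" if "finite G" "G \<subseteq> J" for G
    using that
  proof (induction G)
    case empty
    then show ?case using 1 by auto
  next
    case (insert g G)
    then obtain z where z: "z \<in> S" "\<And>x. x \<in> G \<Longrightarrow> z * x \<in> I"
      by auto
    have g: "g \<in> J" "g \<in> R"
      using insert J by auto
    have zR: "z \<in> R"
      using z by (simp add: S_def)
    obtain a b where ab: "a < b" "g ^ b - g ^ a \<in> I"
      using pigeonhole_mod[OF N(1), of "\<lambda>k. g ^ k"] g R_intros unfolding I_def by metis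
    have "(1 - g ^ (b - a)) * (z * g ^ a) = (g ^ b - g ^ a) * (- z)"
      using ab(1) by (simp add: algebra_simps flip: power_add)
    then have "(1 - g ^ (b - a)) * (z * g ^ a) \<in> I"
      using ab(2) zR by (simp only:) (intro I_intros R_intros)
    moreover have "g ^ (b - a) = g ^ (b - a - 1) * g"
      using power_minus_mult[of "b - a" g] ab(1) by simp
    then have "g ^ (b - a) \<in> J"
      using g by (simp only:) (intro is_submodule_scale[OF J(2)] R_intros)
    ultimately have "z * g ^ a \<notin> S"
      by (auto simp: S_def)
    moreover have "z * g ^ 0 \<in> S"
      using z by simp
    \<comment> \<open>Multiplying \<open>z\<close> by powers of \<open>g\<close> leaves
      \<open>S\<close> at some point. The \<open>j\<close> found there makes
      \<open>(1 - j) * z * g ^ l\<close> annihilated by \<open>g\<close> modulo \<open>N\<close>,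
      and this element is still in \<open>S\<close> because the elements \<open>1 - j\<close> are
      closed under products.\<close>
    ultimately obtain l where l: "z * g ^ l \<in> S" "z * g ^ Suc l \<notin> S"
      using nat_induct[of "\<lambda>l. z * g ^ l \<in> S"] by blast
    have "z * g ^ Suc l \<in> R"
      by (intro R_intros g zR)
    with l(2) obtain j where j: "j \<in> J" "(1 - j) * (z * g ^ Suc l) \<in> I"
      by (auto simp: S_def)
    have jR: "j \<in> R"
      using j J by auto
    define w where "w = (1 - j) * (z * g ^ l)"
    have "(1 - j') * w \<notin> I" if j': "j' \<in> J" for j'
    proof -
      have "j' * j \<in> J"
        using j j' J by (intro is_submodule_scale[OF J(2)]) auto
      then have "j + j' - j' * j \<in> J"
        by (intro is_submodule_diff[OF ring J(2)] is_submodule_add[OF J(2)] j j')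
      moreover have "(1 - j') * w = (1 - (j + j' - j' * j)) * (z * g ^ l)"
        by (simp add: w_def algebra_simps)
      ultimately show ?thesis
        using l(1) unfolding S_def by auto
    qed
    then have "w \<in> S"
      unfolding S_def w_def by (auto intro!: R_intros jR zR g)
    moreover have "w * g \<in> I"
      using j(2) by (simp add: w_def mult_ac)
    moreover have "w * x \<in> I" if "x \<in> G" for x
    proof -
      have "w * x = z * x * ((1 - j) * g ^ l)"
        by (simp add: w_def mult_ac)
      also have "\<dots> \<in> I"
        by (intro I_intros z that R_intros jR g)
      finally show ?thesis .
    qed
    ultimately show ?case
      by blast
  qed
  obtain h :: "'a \<Rightarrow> 'a" where h: "finite (h ` R)"
    "\<And>x y. x \<in> R \<Longrightarrow> y \<in> R \<Longrightarrow> h x = h y \<Longrightarrow> x - y \<in> I"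
    using finite_quotient[OF N(1)] unfolding I_def by metis
  \<comment> \<open>A finite set of representatives of \<open>J\<close> modulo \<open>N\<close>;
    annihilating it means annihilating \<open>J\<close>.\<close>
  define G where "G = inv_into J h ` (h ` J)"
  have "finite G"
    unfolding G_def by (intro finite_imageI finite_subset[OF _ h(1)] image_mono J)
  moreover have "G \<subseteq> J"
    unfolding G_def by (auto intro: inv_into_into)
  ultimately obtain z where z: "z \<in> S" "\<And>g. g \<in> G \<Longrightarrow> z * g \<in> I"
    using annihilator[of G] by blast
  have zR: "z \<in> R"
    using z by (simp add: S_def)
  have "z * x \<in> I" if x: "x \<in> J" for x
  proof -
    define g where "g = inv_into J h (h x)"
    have g: "g \<in> G" "g \<in> J" "h g = h x"
      using x by (simp_all add: g_def G_def inv_into_into f_inv_into_f)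
    have "(x - g) * z + z * g \<in> I"
      using h(2)[of x g] g x J zR by (intro I_intros z) auto
    then show ?thesis
      by (simp add: algebra_simps)
  qed
  then have *: "z / of_nat N * x \<in> R" if "x \<in> J" for x
    using that N(1) by (force simp: I_def)
  have "z / of_nat N \<in> F"
    by (intro F_divide F_intros(10) R_F zR)
  then have "z / of_nat N \<in> R"
    using * by (rule inv)
  then have "(1 - 0) * z \<in> I"
    using N(1) by (force simp: I_def)
  then show False
    using z is_submodule_zero[OF J(2)] by (auto simp: S_def)
qed

section \<open>Inverses and generators of fractional ideals\<close>

definition fractional :: "'a set \<Rightarrow> bool" where
  "fractional M \<longleftrightarrow> M \<subseteq> F \<and> is_submodule R M \<and> (\<exists>x\<in>M. x \<noteq> 0) \<and> (\<exists>d\<in>R. d \<noteq> 0 \<and> (\<forall>x\<in>M. d * x \<in> R))"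

definition inverse_ideal :: "'a set \<Rightarrow> 'a set" where
  "inverse_ideal M = {y \<in> F. \<forall>x\<in>M. y * x \<in> R}"

lemma inverse_ideal_submodule: "is_submodule R (inverse_ideal M)"
  unfolding is_submodule_def inverse_ideal_def
  by (auto simp: distrib_right mult.assoc intro: R_intros F_intros R_F)

lemma inverse_idealD: "y \<in> inverse_ideal M \<Longrightarrow> x \<in> M \<Longrightarrow> y * x \<in> R"
  by (auto simp: inverse_ideal_def)

lemma ex_nat_divide_inverse_ideal:
  assumes "fractional M" "p \<in> M" "p \<noteq> 0"
  shows "\<exists>N>0. of_nat N / p \<in> inverse_ideal M"
proof -
  obtain d where d: "d \<in> R" "d \<noteq> 0" "\<And>x. x \<in> M \<Longrightarrow> d * x \<in> R"
    using assms(1) by (auto simp: fractional_def)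
  have pF: "p \<in> F"
    using assms by (auto simp: fractional_def)
  then obtain N where N: "N > 0" "of_nat N * inverse (p * d) \<in> R"
    using denominator[of "inverse (p * d)"] d R_F by (metis F_inverse F_intros(6))
  have "of_nat N / p * x \<in> R" if "x \<in> M" for x
  proof -
    have "of_nat N / p * x = of_nat N * inverse (p * d) * (d * x)"
      using d(2) assms(3) by (simp add: field_simps)
    also have "\<dots> \<in> R"
      by (intro R_mult N d that)
    finally show ?thesis .
  qed
  then show ?thesis
    using N(1) pF by (auto simp: inverse_ideal_def intro!: F_divide F_intros)
qed

text \<open>Finite sums of products built one summand at a time, so that claims are proved by
  induction on the sum, as in the merging of generators below.\<close>

inductive_set ideal_product :: "'a set \<Rightarrow> 'a set \<Rightarrow> 'a set" for A B where
  zero: "0 \<in> ideal_product A B"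
| step: "a \<in> A \<Longrightarrow> b \<in> B \<Longrightarrow> x \<in> ideal_product A B \<Longrightarrow> a * b + x \<in> ideal_product A B"

lemma ideal_product_submodule:
  assumes "is_submodule R A"
  shows "is_submodule R (ideal_product A B)"
  unfolding is_submodule_def
proof (intro conjI ballI)
  show "0 \<in> ideal_product A B"
    by (rule ideal_product.zero)
next
  fix x y assume "x \<in> ideal_product A B" and y: "y \<in> ideal_product A B"
  then show "x + y \<in> ideal_product A B"
    by (induction) (auto simp: add.assoc intro: ideal_product.step)
next
  fix r x assume r: "r \<in> R" and "x \<in> ideal_product A B"
  from this(2) show "r * x \<in> ideal_product A B"
  proof induction
    case (step a b x)
    then have "(r * a) * b + r * x \<in> ideal_product A B"
      using r by (intro ideal_product.step is_submodule_scale[OF assms])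
    then show ?case
      by (simp add: algebra_simps)
  qed (simp add: ideal_product.zero)
qed

text \<open>If \<open>y\<close> multiplies \<open>M^-1 M\<close> into \<open>R\<close>, then it
  multiplies \<open>M^-1\<close> into itself and lies in \<open>R\<close> by
  \<open>stable_imp_mem\<close>. So \<open>M^-1 M\<close> has no multipliers outside
  \<open>R\<close>, and \<open>one_mem_ideal\<close> applies.\<close>

lemma one_mem_ideal_product_inverse:
  assumes M: "fractional M"
  shows "1 \<in> ideal_product (inverse_ideal M) M"
proof -
  obtain p where p: "p \<in> M" "p \<noteq> 0"
    using M by (auto simp: fractional_def)
  obtain N where N: "N > 0" "of_nat N / p \<in> inverse_ideal M"
    using ex_nat_divide_inverse_ideal[OF M p] by blast
  let ?J = "ideal_product (inverse_ideal M) M"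
  have mem: "v * x \<in> ?J" if "v \<in> inverse_ideal M" "x \<in> M" for v x
    using ideal_product.step[OF that ideal_product.zero] by simp
  show ?thesis
  proof (rule one_mem_ideal[OF _ _ N(1)])
    show "?J \<subseteq> R"
    proof
      fix x assume "x \<in> ?J"
      then show "x \<in> R"
        by induction (auto intro: R_intros inverse_idealD)
    qed
    show "is_submodule R ?J"
      by (intro ideal_product_submodule inverse_ideal_submodule)
    show "of_nat N \<in> ?J"
      using mem[OF N(2) p(1)] p(2) by simp
  next
    fix y assume y: "y \<in> F" "\<And>x. x \<in> ?J \<Longrightarrow> y * x \<in> R"
    show "y \<in> R"
    proof (rule stable_imp_mem[OF y(1) N(2)])
      show "of_nat N / p \<noteq> 0"
        using N p by simp
      show "y * v \<in> inverse_ideal M" if "v \<in> inverse_ideal M" for v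
        using that y mem by (auto simp: inverse_ideal_def mult.assoc intro: F_intros)
      show "p \<noteq> 0"
        by (rule p)
      show "p * v \<in> R" if "v \<in> inverse_ideal M" for v
        using inverse_idealD[OF that p(1)] by (simp add: mult.commute)
    qed
  qed
qed

text \<open>Modulo a natural number in \<open>p M\<^sup>-\<^sup>1\<close> some power \<open>e\<close> of \<open>u * q\<close> is idempotent. If
  \<open>u * q + r * b + y\<close> is \<open>1\<close> modulo \<open>p M\<^sup>-\<^sup>1\<close>, then \<open>e * q + (1 - e) * b\<close> can replace both \<open>q\<close> and \<open>b\<close>.\<close>

lemma fractional_two_generators:
  assumes M: "fractional M"
  shows "\<exists>p\<in>M. \<exists>q\<in>M. \<exists>u\<in>inverse_ideal M. \<exists>v\<in>inverse_ideal M. p * u + q * v = 1"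
proof -
  let ?M' = "inverse_ideal M"
  have MR: "is_submodule R M"
    using M by (auto simp: fractional_def)
  have M'R: "is_submodule R ?M'"
    by (rule inverse_ideal_submodule)
  obtain p where p: "p \<in> M" "p \<noteq> 0"
    using M by (auto simp: fractional_def)
  \<comment> \<open>The goal becomes a congruence: \<open>u * q - 1 \<in> D\<close> says exactly
    that \<open>u * q - 1 = p * v\<close> with \<open>v\<close> in the inverse ideal.\<close>
  define D where "D = (*) p ` ?M'"
  have D: "is_submodule R D"
    using M'R unfolding D_def is_submodule_def
    by (auto simp: image_iff mult.left_commute simp flip: distrib_left)
  obtain N where N: "N > 0" "of_nat N / p \<in> ?M'"
    using ex_nat_divide_inverse_ideal[OF M p] by blast
  have ND: "x \<in> D" if x: "x \<in> (*) (of_nat N) ` R" for x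
  proof -
    obtain r where r: "r \<in> R" "x = of_nat N * r"
      using x by auto
    then have "x = p * (r * (of_nat N / p))"
      using p(2) by simp
    then show ?thesis
      unfolding D_def using is_submodule_scale[OF M'R r(1) N(2)] by blast
  qed
  \<comment> \<open>Invariant: \<open>u * q + c * x\<close> is \<open>1\<close> modulo
    \<open>D\<close>, where \<open>x\<close> is the part of the sum not yet treated. Each step
    absorbs one product \<open>r * b\<close> into \<open>u * q\<close>.\<close>
  have main: "\<exists>q'\<in>M. \<exists>u'\<in>?M'. u' * q' - 1 \<in> D"
    if "x \<in> ideal_product ?M' M" "c \<in> R" "q \<in> M" "u \<in> ?M'" "u * q + c * x - 1 \<in> D" for x c q u
    using that
  proof (induction arbitrary: c q u)
    case zero
    then show ?case by auto
  next
    case (step r b y)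
    define x where "x = u * q"
    have x: "x \<in> R"
      unfolding x_def using step.prems by (intro inverse_idealD)
    obtain k where k: "k > 0" "x ^ k * x ^ k - x ^ k \<in> (*) (of_nat N) ` R"
      using idempotent_power[OF N(1) x] by blast
    define e where "e = x ^ k"
    define \<epsilon> where "\<epsilon> = e * e - e"
    define g where "g = (\<Sum>i<k. x ^ i)"
    define q2 where "q2 = e * q + (1 - e) * b"
    \<comment> \<open>Modulo \<open>N\<close> the idempotent \<open>e\<close> splits the ring. Where
      \<open>e = 1\<close>, \<open>x\<close> is invertible with inverse \<open>x ^ (k - 1)\<close>;
      where \<open>e = 0\<close>, \<open>x\<close> is nilpotent and \<open>g\<close> inverts
      \<open>1 - x\<close>. The two summands treat these parts separately, and \<open>w\<close>
      collects the mixed terms, which carry the factor \<open>\<epsilon>\<close>.\<close>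
    define u2 where "u2 = (e * x ^ (k - 1)) * u + ((1 - e) * g * c) * r"
    define w where "w = x ^ (k - 1) * (u * b) + g * c * (r * q)"
    define t where "t = u * q + c * (r * b + y) - 1"
    have eR: "e \<in> R" and gR: "g \<in> R"
      unfolding e_def g_def by (intro R_intros x)+
    have rb: "r * b \<in> R" and ub: "u * b \<in> R" and rq: "r * q \<in> R"
      using step by (auto intro: inverse_idealD)
    have wR: "w \<in> R"
      unfolding w_def by (intro R_intros(4) R_mult[OF _ ub] R_mult[OF _ rq] R_intros x gR step.prems(1))
    have "(1 - e) * (1 - x) * g = (1 - e) * (1 - e)"
      unfolding g_def e_def using sum_gp_basic[of x "k - 1"] k(1)
      by (simp add: lessThan_Suc_atMost [symmetric] mult.assoc)
    then have gx: "(1 - e) * g * x = (1 - e) * g - (1 - e) * (1 - e)"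
      by (simp add: algebra_simps)
    have ex: "x ^ (k - 1) * (u * q) = e"
      using k(1) unfolding e_def x_def [symmetric] by (simp flip: power_Suc2)
    have "u2 * q2 = (e * e) * (x ^ (k - 1) * (u * q)) - \<epsilon> * w + ((1 - e) + \<epsilon>) * g * c * r * b"
      unfolding u2_def q2_def w_def \<epsilon>_def by (simp add: algebra_simps)
    also have "\<dots> = e * e * e - \<epsilon> * w + ((1 - e) + \<epsilon>) * g * c * r * b"
      unfolding ex ..
    finally have "u2 * q2 + ((1 - e) * g * c) * y - 1 =
        e * e * e - \<epsilon> * w + \<epsilon> * g * c * r * b + (1 - e) * g * (c * (r * b + y)) - 1"
      by (simp add: algebra_simps)
    also have "c * (r * b + y) = 1 - x + t"
      by (simp add: t_def x_def)
    also have "e * e * e - \<epsilon> * w + \<epsilon> * g * c * r * b + (1 - e) * g * (1 - x + t) - 1 =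
        e * e * e - \<epsilon> * w + \<epsilon> * g * c * r * b + (1 - e) * (1 - e) + (1 - e) * g * t - 1"
      using gx by (simp add: algebra_simps)
    also have "\<dots> = \<epsilon> * (2 + e - w + g * c * (r * b)) + (1 - e) * g * t"
      unfolding \<epsilon>_def by (simp add: algebra_simps)
    also have "\<dots> \<in> D"
    proof (rule is_submodule_add[OF D])
      have "\<epsilon> \<in> (*) (of_nat N) ` R"
        using k(2) by (simp add: \<epsilon>_def e_def)
      moreover have "2 + e - w + g * c * (r * b) \<in> R"
        using R_intros(10)[of 2]
        by (intro R_intros(4,5) R_mult[OF _ rb] R_mult[OF gR] eR wR step.prems(1)) simp
      ultimately show "\<epsilon> * (2 + e - w + g * c * (r * b)) \<in> D"
        by (intro ND multiple_mult[OF ring])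
      have "t \<in> D"
        using step.prems(4) by (simp add: t_def)
      then show "(1 - e) * g * t \<in> D"
        by (intro is_submodule_scale[OF D] R_intros eR gR)
    qed
    finally have "u2 * q2 + ((1 - e) * g * c) * y - 1 \<in> D" .
    moreover have "(1 - e) * g * c \<in> R"
      by (intro R_intros eR gR step.prems(1))
    moreover have "q2 \<in> M"
      unfolding q2_def using step
      by (intro is_submodule_add[OF MR] is_submodule_scale[OF MR] R_intros eR)
    moreover have "u2 \<in> ?M'"
      unfolding u2_def using step
      by (intro is_submodule_add[OF M'R] is_submodule_scale[OF M'R] R_intros eR gR x)
    ultimately show ?case
      by (intro step.IH)
  qed
  \<comment> \<open>The invariant starts with \<open>x = 1\<close>, \<open>c = 1\<close> and
    \<open>u = 0\<close>; \<open>p\<close> is a placeholder for \<open>q\<close>.\<close>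
  obtain q u where qu: "q \<in> M" "u \<in> ?M'" "u * q - 1 \<in> D"
    using main[OF one_mem_ideal_product_inverse[OF M] R_intros(1) p(1) is_submodule_zero[OF M'R]]
      is_submodule_zero[OF D] by auto
  then obtain v where v: "v \<in> ?M'" "u * q - 1 = p * v"
    by (auto simp: D_def)
  then have "q * u + p * (- v) = 1"
    by (simp add: algebra_simps)
  then show ?thesis
    using p qu is_submodule_minus[OF ring M'R v(1)] by blast
qed

lemma fractional_iff:
  assumes "R = ring_of_integers F"
  shows "M \<in> fractional_ideals F \<longleftrightarrow> fractional M"
  using assms is_submodule_zero[of R M] unfolding fractional_ideals_def fractional_def by blast

end

lemma (in cyclotomic) number_ring_field: "number_ring (adjoin \<rat> \<eta>) Z"
proof
  show "x \<in> Z" if "x \<in> adjoin \<rat> \<eta>" "i < j" "x ^ j - x ^ i \<in> Z" for x i j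
  proof (rule integral_over_Z[OF that(1)])
    \<comment> \<open>Coefficients of the equation \<open>X ^ j = X ^ i + (x ^ j - x ^ i)\<close>;
      they are added because both fall on the constant term when \<open>i = 0\<close>.\<close>
    define a where "a k = (if k = 0 then x ^ j - x ^ i else 0) + (if k = i then 1 else 0)" for k
    have "a k * x ^ k = (if k = 0 then x ^ j - x ^ i else 0) + (if k = i then x ^ i else 0)" for k
      by (simp add: a_def)
    then have "(\<Sum>k<j. a k * x ^ k) = x ^ j"
      using that(2) by (simp add: sum.distrib)
    moreover have "\<forall>k<j. a k \<in> Z"
      using that(3) Z_intros by (auto simp: a_def)
    ultimately show "integral_over Z x"
      unfolding integral_over_def[OF Z_subring] by (intro exI[of _ j] exI[of _ a]) simp
  qed
qed (use is_subfield_adjoin Z_subring Z_subset_field field_multiple_nat Z_finite_quotient in auto)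

text \<open>This carries the ideal theory over to the fixed field without a description of its ring
  of integers: every property descends by intersecting with \<open>K\<close>.\<close>

lemma number_ring_subfield:
  assumes "number_ring L R" "is_subfield K" "K \<subseteq> L"
  shows "number_ring K (R \<inter> K)"
proof -
  interpret number_ring L R by fact
  have K: "is_subring K"
    by (rule is_subfield_imp_subring[OF assms(2)])
  show ?thesis
  proof
    show "is_subring (R \<inter> K)"
      using ring K by (auto simp: is_subring_def)
    show "\<exists>k>0. of_nat k * x \<in> R \<inter> K" if "x \<in> K" for x
      using that assms(3) denominator[of x] subring_mult[OF K subring_of_nat[OF K] that] by auto
  next
    fix N :: nat assume N: "N > 0"
    obtain h :: "'a \<Rightarrow> 'a" where h: "finite (h ` R)"
      "\<And>x y. x \<in> R \<Longrightarrow> y \<in> R \<Longrightarrow> h x = h y \<Longrightarrow> x - y \<in> (*) (of_nat N) ` R"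
      using finite_quotient[OF N] by metis
    have "x - y \<in> (*) (of_nat N) ` (R \<inter> K)" if xy: "x \<in> R \<inter> K" "y \<in> R \<inter> K" "h x = h y" for x y
    proof -
      obtain r where r: "r \<in> R" "x - y = of_nat N * r"
        using h(2)[of x y] xy by auto
      then have "r = (x - y) * inverse (of_nat N)"
        using N by (simp add: field_simps)
      also have "\<dots> \<in> K"
        using xy assms(2) subring_of_nat[OF K, of N]
        by (intro subring_mult[OF K] subring_diff[OF K]) (auto simp: is_subfield_def)
      finally show ?thesis
        using r by blast
    qed
    then show "\<exists>h :: 'a \<Rightarrow> 'a. finite (h ` (R \<inter> K)) \<and>
        (\<forall>x\<in>R \<inter> K. \<forall>y\<in>R \<inter> K. h x = h y \<longrightarrow> x - y \<in> (*) (of_nat N) ` (R \<inter> K))"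
      using h(1) by (intro exI[of _ h]) (auto intro: finite_subset[OF image_mono])
  next
    fix x :: 'a and i j :: nat assume "x \<in> K" "i < j" "x ^ j - x ^ i \<in> R \<inter> K"
    then show "x \<in> R \<inter> K"
      using root_closed[of x i j] assms(3) by auto
  qed (use assms in auto)
qed

section \<open>Relative norms and freeness\<close>

lemma is_submodule_hull: "is_submodule R (is_submodule R hull S)"
  by (rule hull_in) (auto simp: is_submodule_def)

lemma is_submodule_principal:
  assumes "is_subring R"
  shows "is_submodule R ((\<lambda>r. r * x) ` R)"
  unfolding is_submodule_def
proof (intro conjI ballI)
  show "0 \<in> (\<lambda>r. r * x) ` R"
    using subring_zero[OF assms] by force
next
  fix y z assume "y \<in> (\<lambda>r. r * x) ` R" "z \<in> (\<lambda>r. r * x) ` R"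
  then show "y + z \<in> (\<lambda>r. r * x) ` R"
    using subring_add[OF assms] by (auto simp flip: distrib_right)
next
  fix r y assume "r \<in> R" "y \<in> (\<lambda>r. r * x) ` R"
  then show "r * y \<in> (\<lambda>r. r * x) ` R"
    using subring_mult[OF assms] by (auto simp flip: mult.assoc)
qed

lemma is_submodule_image_mult:
  assumes "is_submodule R J"
  shows "is_submodule R ((*) x ` J)"
  using assms unfolding is_submodule_def
  by (auto simp: image_iff mult.left_commute simp flip: distrib_left)

lemma Rats_subset_subfield:
  fixes F :: "'a::field_char_0 set"
  assumes "is_subfield F"
  shows "\<rat> \<subseteq> F"
proof
  fix x :: 'a assume "x \<in> \<rat>"
  then obtain a b where "x = of_int a / of_int b"
    by (metis Rats_cases')
  then show "x \<in> F"
    using assms subring_of_int[OF is_subfield_imp_subring[OF assms]]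
    by (simp add: divide_inverse is_subfield_def)
qed

section \<open>The quadratic extension cut out by an involution\<close>

locale cyclotomic_involution = cyclotomic +
  fixes \<sigma> :: "'a \<Rightarrow> 'a"
  assumes Gal: "\<sigma> \<in> Gal (adjoin \<rat> \<eta>) \<rat>"
    and nontrivial: "\<exists>x\<in>adjoin \<rat> \<eta>. \<sigma> x \<noteq> x"
    and involution: "\<forall>x\<in>adjoin \<rat> \<eta>. \<sigma> (\<sigma> x) = x"
begin

abbreviation "L \<equiv> adjoin \<rat> \<eta>"

definition "K = fixed_field L \<sigma>"

abbreviation "OK \<equiv> Z \<inter> K"

sublocale NL: number_ring L Z
  by (rule number_ring_field)

lemma sigma_in_L: "x \<in> L \<Longrightarrow> \<sigma> x \<in> L"
  using Gal by (auto simp: Gal_def bij_betw_def)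

lemma sigma_add: "x \<in> L \<Longrightarrow> y \<in> L \<Longrightarrow> \<sigma> (x + y) = \<sigma> x + \<sigma> y"
  and sigma_mult: "x \<in> L \<Longrightarrow> y \<in> L \<Longrightarrow> \<sigma> (x * y) = \<sigma> x * \<sigma> y"
  and sigma_Rats: "x \<in> \<rat> \<Longrightarrow> \<sigma> x = x"
  using Gal by (auto simp: Gal_def)

lemma sigma_zero: "\<sigma> 0 = 0" and sigma_one: "\<sigma> 1 = 1"
  by (auto intro: sigma_Rats)

lemma sigma_minus: "x \<in> L \<Longrightarrow> \<sigma> (- x) = - \<sigma> x"
  using sigma_mult[of "- 1" x] sigma_Rats[of "- 1"] NL.F_intros(1,3) by simp

lemma sigma_diff: "x \<in> L \<Longrightarrow> y \<in> L \<Longrightarrow> \<sigma> (x - y) = \<sigma> x - \<sigma> y"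
  using sigma_add[of x "- y"] sigma_minus[of y] NL.F_intros(3)[of y] by simp

lemma sigma_inverse: "x \<in> L \<Longrightarrow> \<sigma> (inverse x) = inverse (\<sigma> x)"
proof (cases "x = 0")
  case False
  assume x: "x \<in> L"
  have "\<sigma> x * \<sigma> (inverse x) = 1"
    using sigma_mult[OF x NL.F_inverse[OF x]] False sigma_one by simp
  then show ?thesis
    by (metis inverse_unique)
qed (simp add: sigma_zero)

lemma sigma_power: "x \<in> L \<Longrightarrow> \<sigma> (x ^ k) = \<sigma> x ^ k"
  by (induction k) (auto simp: sigma_one sigma_mult NL.F_intros(7))

lemma sigma_eq_zero: "x \<in> L \<Longrightarrow> \<sigma> x = 0 \<longleftrightarrow> x = 0"
  using involution sigma_zero by metis

lemma sigma_K: "x \<in> K \<Longrightarrow> \<sigma> x = x"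
  and K_L: "x \<in> K \<Longrightarrow> x \<in> L"
  by (auto simp: K_def fixed_field_def)

lemma K_subfield: "is_subfield K"
  unfolding is_subfield_def K_def fixed_field_def
  by (auto simp: sigma_zero sigma_one sigma_add sigma_mult sigma_minus sigma_inverse
      intro: NL.F_intros NL.F_inverse)

sublocale NK: number_ring K OK
  by (rule number_ring_subfield[OF number_ring_field K_subfield]) (auto intro: K_L)

lemma ring_of_integers_L: "ring_of_integers L = Z"
  by (rule ring_of_integers_eq_Z)

lemma ring_of_integers_K: "ring_of_integers K = OK"
  using ring_of_integers_eq_Z K_L by (auto simp: ring_of_integers_def)

lemma OK_Z: "x \<in> OK \<Longrightarrow> x \<in> Z" and OK_K: "x \<in> OK \<Longrightarrow> x \<in> K"
  by auto

lemma eta_L: "\<eta> \<in> L"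
  by (rule adjoin_gen)

lemma sigma_eta_L: "\<sigma> \<eta> \<in> L"
  by (intro sigma_in_L eta_L)

lemma sigma_eta: "\<sigma> \<eta> \<noteq> \<eta>"
proof
  assume "\<sigma> \<eta> = \<eta>"
  then have "\<eta> \<in> K"
    by (simp add: K_def fixed_field_def eta_L)
  then have "L \<subseteq> K"
    using K_subfield Rats_subset_subfield by (intro adjoin_subset)
  then show False
    using nontrivial sigma_K by auto
qed

lemma eta_notin_K: "\<eta> \<notin> K"
  using sigma_eta sigma_K by auto

lemma sigma_eta_Z: "\<sigma> \<eta> \<in> Z"
proof (rule integral_over_Z[OF sigma_eta_L])
  have "\<sigma> \<eta> ^ n = 1"
    using sigma_power[OF eta_L, of n] by (simp add: eta_power_n sigma_one)
  then have "\<sigma> \<eta> ^ n = (\<Sum>i<n. (if i = 0 then 1 else 0) * \<sigma> \<eta> ^ i)"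
    using n_pos by (simp add: if_distrib[of "\<lambda>x. x * _"] cong: if_cong)
  then show "integral_over Z (\<sigma> \<eta>)"
    unfolding integral_over_def[OF Z_subring]
    by (intro exI[of _ n] exI[of _ "\<lambda>i. if i = 0 then 1 else 0"]) (auto intro: Z_intros)
qed

definition "\<tau> = \<eta> + \<sigma> \<eta>"
definition "\<delta> = \<eta> * \<sigma> \<eta>"

lemma tau_OK: "\<tau> \<in> OK" and delta_OK: "\<delta> \<in> OK"
  using involution eta_L sigma_eta_L
  by (auto simp: \<tau>_def \<delta>_def K_def fixed_field_def sigma_add sigma_mult add.commute mult.commute
      intro!: Z_intros eta_in_Z sigma_eta_Z NL.F_intros)

lemma eta_square: "\<eta> * \<eta> = \<tau> * \<eta> - \<delta>"
  by (simp add: \<tau>_def \<delta>_def algebra_simps)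

lemma K_basis:
  assumes "x \<in> L"
  obtains u v where "u \<in> K" "v \<in> K" "x = u + v * \<eta>"
proof -
  define w where "w = inverse (\<eta> - \<sigma> \<eta>)"
  have w: "w \<in> L" "\<sigma> w = - w" "w * (\<eta> - \<sigma> \<eta>) = 1"
    using sigma_eta involution eta_L sigma_eta_L
    by (auto simp: w_def sigma_inverse sigma_diff NL.F_intros NL.F_inverse simp flip: inverse_minus_eq)
  \<comment> \<open>This solves \<open>x = u + v * \<eta>\<close> together with its image under
    \<open>\<sigma>\<close>. Both \<open>x - \<sigma> x\<close> and \<open>w\<close> change sign
    under \<open>\<sigma>\<close>, so \<open>v\<close> is fixed.\<close>
  define v where "v = (x - \<sigma> x) * w"
  have "\<sigma> v = v"
    using assms w involution by (simp add: v_def sigma_mult sigma_diff sigma_in_L NL.F_intros algebra_simps)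
  then have v: "v \<in> K"
    using assms w sigma_in_L by (auto simp: K_def fixed_field_def v_def intro!: NL.F_intros)
  have "x - \<sigma> x = v * (\<eta> - \<sigma> \<eta>)"
    unfolding v_def mult.assoc w(3) by simp
  then have "\<sigma> (x - v * \<eta>) = x - v * \<eta>"
    using assms v K_L[OF v] by (simp add: sigma_diff sigma_mult sigma_K NL.F_intros eta_L algebra_simps)
  then have "x - v * \<eta> \<in> K"
    using assms K_L[OF v] by (auto simp: K_def fixed_field_def intro!: NL.F_intros eta_L)
  from that[OF this v] show thesis
    by simp
qed

lemma K_basis_unique:
  assumes "u \<in> K" "v \<in> K" "u' \<in> K" "v' \<in> K" "u + v * \<eta> = u' + v' * \<eta>"
  shows "u = u'" "v = v'"
proof -
  have *: "(v - v') * \<eta> = u' - u"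
    using assms(5) by (simp add: algebra_simps)
  show "v = v'"
  proof (rule ccontr)
    assume "v \<noteq> v'"
    then have "\<eta> = (u' - u) / (v - v')"
      using * by (simp add: field_simps)
    also have "\<dots> \<in> K"
      by (intro NK.F_divide NK.F_intros assms)
    finally show False
      using eta_notin_K by simp
  qed
  then show "u = u'"
    using assms(5) by simp
qed

text \<open>Since \<open>\<eta>\<close> satisfies a monic quadratic equation over
  \<open>O_K\<close>, the module \<open>O_K + O_K \<eta>\<close> is stable under
  \<open>\<eta>\<close>, and the Horner induction stays inside it.\<close>

lemma OK_basis:
  assumes "x \<in> Z"
  obtains u v where "u \<in> OK" "v \<in> OK" "x = u + v * \<eta>"
proof -
  have "\<exists>u\<in>OK. \<exists>v\<in>OK. x = u + v * \<eta>"
    using assms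
  proof (induction rule: Z_induct)
    case zero
    then show ?case
      using NK.R_intros(2) by (auto intro!: bexI[of _ 0])
  next
    case (step c y)
    then obtain u v where uv: "u \<in> OK" "v \<in> OK" "y = u + v * \<eta>"
      by blast
    have "of_int c + \<eta> * y = (of_int c - v * \<delta>) + (u + v * \<tau>) * \<eta>"
      unfolding uv(3) distrib_left mult.left_commute[of \<eta> v] eta_square by (simp add: algebra_simps)
    moreover have "of_int c - v * \<delta> \<in> OK" "u + v * \<tau> \<in> OK"
      by (intro NK.R_intros uv tau_OK delta_OK)+
    ultimately show ?case
      by blast
  qed
  then show ?thesis
    using that by blast
qed

text \<open>The device for integrality in \<open>K\<close>: an element of \<open>K\<close> is placed
  in \<open>O_K\<close> by exhibiting it as the \<open>\<eta>\<close>-coordinate of an element of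
  \<open>Z\<close>.\<close>

lemma OK_if_Z:
  assumes "u \<in> K" "v \<in> K" "u + v * \<eta> \<in> Z"
  shows "u \<in> OK" "v \<in> OK"
proof -
  obtain u' v' where "u' \<in> OK" "v' \<in> OK" "u + v * \<eta> = u' + v' * \<eta>"
    using OK_basis[OF assms(3)] by blast
  then show "u \<in> OK" "v \<in> OK"
    using K_basis_unique[of u v u' v'] assms by auto
qed

text \<open>An automorphism over \<open>K\<close> is determined by the image of
  \<open>\<eta>\<close>, a root of \<open>X^2 - \<tau> X + \<delta>\<close>, whose roots are
  \<open>\<eta>\<close> and \<open>\<sigma> \<eta>\<close>. The identity appears restricted because
  elements of \<open>Gal\<close> are extensional.\<close>

lemma Gal_L_K: "Gal L K = {\<sigma>, restrict id L}"
proof (intro equalityI subsetI)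
  fix s assume s: "s \<in> Gal L K"
  then have add: "\<And>x y. x \<in> L \<Longrightarrow> y \<in> L \<Longrightarrow> s (x + y) = s x + s y"
    and mult: "\<And>x y. x \<in> L \<Longrightarrow> y \<in> L \<Longrightarrow> s (x * y) = s x * s y"
    and fixK: "\<And>x. x \<in> K \<Longrightarrow> s x = x" and ext: "s \<in> extensional L"
    by (auto simp: Gal_def)
  have basis: "s (u + v * \<eta>) = u + v * s \<eta>" if "u \<in> K" "v \<in> K" for u v
    using that by (simp add: add mult fixK K_L eta_L NL.F_intros)
  have "\<eta> * \<eta> = - \<delta> + \<tau> * \<eta>"
    using eta_square by simp
  then have "s \<eta> * s \<eta> = - \<delta> + \<tau> * s \<eta>"
    using mult[OF eta_L eta_L] basis[of "- \<delta>" \<tau>] tau_OK delta_OK NK.F_intros(3) by auto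
  then have "(s \<eta> - \<eta>) * (s \<eta> - \<sigma> \<eta>) = 0"
    by (simp add: \<tau>_def \<delta>_def algebra_simps)
  then consider "s \<eta> = \<eta>" | "s \<eta> = \<sigma> \<eta>"
    by auto
  then show "s \<in> {\<sigma>, restrict id L}"
  proof cases
    case 1
    have "s x = restrict id L x" if x: "x \<in> L" for x
      using K_basis[OF x] basis 1 x by (metis id_apply restrict_apply')
    then have "s = restrict id L"
      using ext by (intro extensionalityI[of _ L]) auto
    then show ?thesis by simp
  next
    case 2
    have "s x = \<sigma> x" if x: "x \<in> L" for x
    proof -
      obtain u v where uv: "u \<in> K" "v \<in> K" "x = u + v * \<eta>"
        using K_basis[OF x] .
      then show ?thesis
        using basis[of u v] 2 by (simp add: sigma_add sigma_mult sigma_K K_L eta_L NL.F_intros)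
    qed
    then have "s = \<sigma>"
      using ext Gal by (intro extensionalityI[of _ L]) (auto simp: Gal_def)
    then show ?thesis by simp
  qed
next
  fix s assume "s \<in> {\<sigma>, restrict id L}"
  moreover have "\<sigma> \<in> Gal L K"
    using Gal sigma_K by (auto simp: Gal_def)
  moreover have "restrict id L \<in> Gal L K"
    using K_L by (auto simp: Gal_def bij_betw_def inj_on_def NL.F_intros)
  ultimately show "s \<in> Gal L K"
    by blast
qed

lemma rel_norm_eq:
  assumes "x \<in> L"
  shows "rel_norm L K x = x * \<sigma> x"
proof -
  have "restrict id L \<eta> \<noteq> \<sigma> \<eta>"
    using sigma_eta eta_L by simp
  then have "\<sigma> \<noteq> restrict id L"
    by metis
  then show ?thesis
    using assms by (simp add: rel_norm_def Gal_L_K)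
qed

lemma L_fractional_mult_eta:
  assumes "NL.fractional J" "x \<in> J"
  shows "\<eta> * x \<in> J"
  using assms eta_in_Z by (auto simp: NL.fractional_def is_submodule_def)

text \<open>For the basis \<open>\<alpha>\<close>, \<open>\<beta>\<close> the norm is \<open>\<kappa>\<close> times a quadratic form with coefficients \<open>b\<close>, \<open>d - a\<close>, \<open>- c\<close>
  read off from the matrix of \<open>\<eta>\<close>. The form is primitive: if \<open>y \<in> K\<close> multiplies its coefficients into
  \<open>O\<^sub>K\<close>, then \<open>y (\<eta> - a)\<close> preserves \<open>J\<close> and hence lies in \<open>O\<^sub>K + O\<^sub>K \<eta>\<close>.\<close>

lemma principal_norm_if_basis:
  assumes J: "NL.fractional J" and basis: "J = {x * \<alpha> + y * \<beta> | x y. x \<in> OK \<and> y \<in> OK}"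
  shows "rel_ideal_norm L K J \<in> principal_ideals K"
proof -
  have JL: "J \<subseteq> L" and JZ: "is_submodule Z J"
    using J by (auto simp: NL.fractional_def)
  obtain m where m: "m \<in> J" "m \<noteq> 0"
    using J by (auto simp: NL.fractional_def)
  obtain D where D: "D \<noteq> 0" "\<And>x. x \<in> J \<Longrightarrow> D * x \<in> Z"
    using J by (auto simp: NL.fractional_def)
  have memJ: "x * \<alpha> + y * \<beta> \<in> J" if "x \<in> OK" "y \<in> OK" for x y
    using that basis by blast
  have \<alpha>J: "\<alpha> \<in> J" and \<beta>J: "\<beta> \<in> J"
    using memJ[of 1 0] memJ[of 0 1] NK.R_intros(1,2) by auto
  have \<alpha>L: "\<alpha> \<in> L" and \<beta>L: "\<beta> \<in> L"
    using \<alpha>J \<beta>J JL by auto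
  obtain a b where ab: "a \<in> OK" "b \<in> OK" "\<eta> * \<alpha> = a * \<alpha> + b * \<beta>"
    using L_fractional_mult_eta[OF J \<alpha>J] basis by auto
  obtain c d where cd: "c \<in> OK" "d \<in> OK" "\<eta> * \<beta> = c * \<alpha> + d * \<beta>"
    using L_fractional_mult_eta[OF J \<beta>J] basis by auto
  have \<alpha>0: "\<alpha> \<noteq> 0"
  proof
    assume "\<alpha> = 0"
    moreover from this have "\<beta> \<noteq> 0"
      using m basis by auto
    ultimately have "\<eta> = d"
      using cd(3) by simp
    then show False
      using eta_notin_K cd(2) by auto
  qed
  have b0: "b \<noteq> 0"
  proof
    assume "b = 0"
    then have "\<eta> = a"
      using ab(3) \<alpha>0 by simp
    then show False
      using eta_notin_K ab(1) by auto
  qed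
  have b\<beta>: "b * \<beta> = (\<eta> - a) * \<alpha>"
    using ab(3) by (simp add: algebra_simps)
  have "(\<eta> - d) * (\<eta> - a) * \<alpha> = b * ((\<eta> - d) * \<beta>)"
    using b\<beta> by (simp add: mult_ac)
  also have "(\<eta> - d) * \<beta> = c * \<alpha>"
    using cd(3) by (simp add: algebra_simps)
  finally have "(\<eta> - d) * (\<eta> - a) = b * c"
    using \<alpha>0 by simp
  then have "(\<eta> * \<eta>) = (b * c - a * d) + (a + d) * \<eta>"
    by (simp add: algebra_simps)
  then have "- \<delta> + \<tau> * \<eta> = (b * c - a * d) + (a + d) * \<eta>"
    using eta_square by simp
  moreover have "- \<delta> \<in> K" "\<tau> \<in> K" "b * c - a * d \<in> K" "a + d \<in> K"
    using ab cd tau_OK delta_OK by (auto intro!: NK.F_intros)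
  ultimately have \<tau>: "\<tau> = a + d" and \<delta>: "\<delta> = a * d - b * c"
    using K_basis_unique[of "- \<delta>" \<tau> "b * c - a * d" "a + d"] by (auto simp: algebra_simps)
  \<comment> \<open>From \<open>b * \<beta> = (\<eta> - a) * \<alpha>\<close>, \<open>b^2\<close>
    times the norm of \<open>x * \<alpha> + y * \<beta>\<close> is the norm of
    \<open>\<alpha>\<close> times that of \<open>b * x + y * (\<eta> - a)\<close>, and the latter is
    \<open>b * f x y\<close> for the form \<open>f\<close> below.\<close>
  define \<kappa> where "\<kappa> = \<alpha> * \<sigma> \<alpha> / b"
  have "\<alpha> * \<sigma> \<alpha> \<in> K"
    using involution \<alpha>L by (auto simp: K_def fixed_field_def sigma_mult sigma_in_L mult.commute intro!: NL.F_intros)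
  then have \<kappa>K: "\<kappa> \<in> K"
    unfolding \<kappa>_def using ab(2) by (intro NK.F_divide) auto
  have \<kappa>0: "\<kappa> \<noteq> 0"
    using \<alpha>0 b0 \<alpha>L by (simp add: \<kappa>_def sigma_eq_zero)
  define f where "f x y = b * x * x + (d - a) * x * y - c * y * y" for x y
  have norm: "rel_norm L K (x * \<alpha> + y * \<beta>) = \<kappa> * f x y" if xy: "x \<in> OK" "y \<in> OK" for x y
  proof -
    have \<sigma>b: "b * \<sigma> \<beta> = (\<sigma> \<eta> - a) * \<sigma> \<alpha>"
      using arg_cong[OF b\<beta>, of \<sigma>] ab \<alpha>L \<beta>L
      by (simp add: sigma_mult sigma_diff sigma_K K_L eta_L NL.F_intros)
    have "b * b * rel_norm L K (x * \<alpha> + y * \<beta>) = (b * (x * \<alpha> + y * \<beta>)) * (b * \<sigma> (x * \<alpha> + y * \<beta>))"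
      using xy \<alpha>L \<beta>L memJ[OF xy] JL by (simp add: rel_norm_eq subset_iff)
    also have "b * \<sigma> (x * \<alpha> + y * \<beta>) = x * b * \<sigma> \<alpha> + y * (b * \<sigma> \<beta>)"
      using xy \<alpha>L \<beta>L by (simp add: sigma_add sigma_mult sigma_K K_L NL.F_intros algebra_simps)
    also have "\<dots> = (b * x + y * (\<sigma> \<eta> - a)) * \<sigma> \<alpha>"
      unfolding \<sigma>b by (simp add: algebra_simps)
    also have "b * (x * \<alpha> + y * \<beta>) = b * x * \<alpha> + y * (b * \<beta>)"
      by (simp add: algebra_simps)
    also have "\<dots> = (b * x + y * (\<eta> - a)) * \<alpha>"
      unfolding b\<beta> by (simp add: algebra_simps)
    finally have "b * b * rel_norm L K (x * \<alpha> + y * \<beta>) =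
        (\<alpha> * \<sigma> \<alpha>) * (b * x * b * x + b * x * y * (\<tau> - 2 * a) + y * y * (\<delta> - a * \<tau> + a * a))"
      by (simp add: \<tau>_def \<delta>_def algebra_simps)
    also have "\<dots> = b * b * (\<kappa> * f x y)"
      using b0 unfolding \<tau> \<delta> \<kappa>_def f_def by (simp add: field_simps)
    finally show ?thesis
      using b0 by simp
  qed
  have f: "f x y \<in> OK" if "x \<in> OK" "y \<in> OK" for x y
    unfolding f_def by (intro NK.R_intros ab cd that)
  define H where "H = is_submodule OK hull (rel_norm L K ` J)"
  have H: "is_submodule OK H"
    unfolding H_def by (rule is_submodule_hull)
  define I where "I = {r \<in> OK. \<kappa> * r \<in> H}"
  have I: "is_submodule OK I"
  proof -
    have "\<kappa> * (x + y) \<in> H" if "\<kappa> * x \<in> H" "\<kappa> * y \<in> H" for x y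
      using is_submodule_add[OF H that] by (simp add: algebra_simps)
    moreover have "\<kappa> * (r * x) \<in> H" if "r \<in> OK" "\<kappa> * x \<in> H" for r x
      using is_submodule_scale[OF H that] by (simp add: mult_ac)
    ultimately show ?thesis
      unfolding is_submodule_def I_def
      using is_submodule_zero[OF H] NK.R_intros(2,4) NK.R_mult by (simp del: Int_iff)
  qed
  have fI: "f x y \<in> I" if xy: "x \<in> OK" "y \<in> OK" for x y
  proof -
    have "rel_norm L K (x * \<alpha> + y * \<beta>) \<in> H"
      using memJ[OF xy] hull_subset[of "rel_norm L K ` J"] unfolding H_def by blast
    then show ?thesis
      using f[OF xy] norm[OF xy] by (simp add: I_def)
  qed
  \<comment> \<open>The values of \<open>f\<close> at \<open>(1, 0)\<close>, \<open>(0, 1)\<close>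
    and \<open>(1, 1)\<close> recover its coefficients.\<close>
  have bI: "b \<in> I" and cI: "c \<in> I" and adI: "d - a \<in> I"
  proof -
    show b: "b \<in> I"
      using fI[of 1 0] NK.R_intros(1,2) by (simp add: f_def)
    show c: "c \<in> I"
      using is_submodule_minus[OF NK.ring I fI[of 0 1]] NK.R_intros(1,2) by (simp add: f_def)
    have "f 1 1 \<in> I"
      by (intro fI NK.R_intros)
    then have "f 1 1 - b + c \<in> I"
      by (intro is_submodule_add[OF I] is_submodule_diff[OF NK.ring I] b c)
    then show "d - a \<in> I"
      by (simp add: f_def)
  qed
  obtain N where N: "N > 0" "of_nat N * inverse b \<in> OK"
    using NK.denominator[of "inverse b"] NK.F_inverse ab(2) by blast
  have "1 \<in> I"
  proof (rule NK.one_mem_ideal[OF _ I N(1)])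
    show "I \<subseteq> OK"
      by (auto simp: I_def)
    show "of_nat N \<in> I"
      using is_submodule_scale[OF I N(2) bI] b0 by (simp add: mult.assoc)
    fix y assume y: "y \<in> K" "\<And>x. x \<in> I \<Longrightarrow> y * x \<in> OK"
    have "- (y * a) + y * \<eta> \<in> Z"
    proof (rule NL.stable_imp_mem[OF _ m _ D])
      show "- (y * a) + y * \<eta> \<in> L"
        using y ab by (intro NL.F_intros eta_L) (auto intro: K_L)
      fix x assume "x \<in> J"
      then obtain u v where uv: "u \<in> OK" "v \<in> OK" "x = u * \<alpha> + v * \<beta>"
        using basis by auto
      have "(- (y * a) + y * \<eta>) * x = u * y * ((\<eta> - a) * \<alpha>) + v * y * (\<eta> * \<beta> - a * \<beta>)"
        unfolding uv by (simp add: algebra_simps)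
      also have "\<dots> = (v * (y * c)) * \<alpha> + (u * (y * b) + v * (y * (d - a))) * \<beta>"
        unfolding b\<beta> [symmetric] cd(3) by (simp add: algebra_simps)
      also have "\<dots> \<in> J"
        by (intro memJ NK.R_intros(4) NK.R_mult uv y bI cI adI)
      finally show "(- (y * a) + y * \<eta>) * x \<in> J" .
    qed
    then show "y \<in> OK"
      using OK_if_Z[of "- (y * a)" y] y(1) ab(1) by (auto intro: NK.F_intros)
  qed
  then have \<kappa>H: "\<kappa> \<in> H"
    by (simp add: I_def)
  have "H = (\<lambda>r. r * \<kappa>) ` OK"
  proof
    show "H \<subseteq> (\<lambda>r. r * \<kappa>) ` OK"
      unfolding H_def
    proof (rule hull_minimal)
      show "rel_norm L K ` J \<subseteq> (\<lambda>r. r * \<kappa>) ` OK"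
        using basis norm f by (auto simp: mult.commute)
      show "is_submodule OK ((\<lambda>r. r * \<kappa>) ` OK)"
        by (rule is_submodule_principal[OF NK.ring])
    qed
    show "(\<lambda>r. r * \<kappa>) ` OK \<subseteq> H"
      using is_submodule_scale[OF H _ \<kappa>H] by auto
  qed
  then show ?thesis
    unfolding rel_ideal_norm_def principal_ideals_def ring_of_integers_K H_def using \<kappa>K \<kappa>0 by blast
qed

text \<open>Extends integrality from squares to mixed products, whose squares are products of
  integral elements. Root closedness is used with exponents \<open>2\<close> and
  \<open>0\<close>.\<close>

lemma OK_if_square: "y \<in> K \<Longrightarrow> y * y \<in> OK \<Longrightarrow> y \<in> OK"
  using NK.root_closed[of y 0 2] NK.R_intros(5)[OF _ NK.R_intros(1), of "y * y"]
  by (simp add: power2_eq_square del: Int_iff)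

text \<open>With \<open>A = J \<inter> K\<close> and \<open>B\<close> the ideal of \<open>\<eta>\<close>-coordinates of \<open>J\<close>, invertibility of \<open>B\<close> gives
  \<open>J = A \<oplus> B s\<close> for some \<open>s = u0 + \<eta>\<close>. The norm of \<open>J\<close> is \<open>A B\<close>; if it is generated by \<open>\<kappa>\<close>, then
  \<open>A = \<kappa> B\<^sup>-\<^sup>1\<close>, and \<open>B\<^sup>-\<^sup>1 \<oplus> B\<close> is free because \<open>B\<close> is generated by two elements.\<close>

lemma basis_if_principal_norm:
  assumes J: "NL.fractional J" and principal: "rel_ideal_norm L K J \<in> principal_ideals K"
  shows "\<exists>\<alpha> \<beta>. J = {x * \<alpha> + y * \<beta> | x y. x \<in> OK \<and> y \<in> OK}"
proof -
  have JL: "J \<subseteq> L" and JZ: "is_submodule Z J"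
    using J by (auto simp: NL.fractional_def)
  note J_intros = is_submodule_add[OF JZ] is_submodule_diff[OF Z_subring JZ]
  have J_scale: "r * x \<in> J" if "r \<in> OK" "x \<in> J" for r x
    using is_submodule_scale[OF JZ OK_Z[OF that(1)] that(2)] .
  define A where "A = J \<inter> K"
  define B where "B = {v \<in> K. \<exists>u\<in>K. u + v * \<eta> \<in> J}"
  have A: "is_submodule OK A"
    using is_submodule_zero[OF JZ] J_intros J_scale NK.F_intros(2,4) NK.F_intros(6)[OF OK_K]
    unfolding is_submodule_def A_def by auto
  have B: "is_submodule OK B"
    unfolding is_submodule_def
  proof (intro conjI ballI)
    show "0 \<in> B"
      using is_submodule_zero[OF JZ] NK.F_intros(2) by (auto simp: B_def intro!: bexI[of _ 0])
  next
    fix v v' assume "v \<in> B" "v' \<in> B"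
    then obtain u u' where u: "u \<in> K" "u' \<in> K" "v \<in> K" "v' \<in> K" "u + v * \<eta> \<in> J" "u' + v' * \<eta> \<in> J"
      by (auto simp: B_def)
    then have "(u + u') + (v + v') * \<eta> \<in> J"
      using J_intros(1)[OF u(5,6)] by (simp add: algebra_simps)
    then show "v + v' \<in> B"
      using u by (auto simp: B_def intro!: NK.F_intros bexI[of _ "u + u'"])
  next
    fix r v assume r: "r \<in> OK" and "v \<in> B"
    then obtain u where u: "u \<in> K" "v \<in> K" "u + v * \<eta> \<in> J"
      by (auto simp: B_def)
    then have "r * u + r * v * \<eta> \<in> J"
      using J_scale[OF r u(3)] by (simp add: algebra_simps)
    then show "r * v \<in> B"
      using u OK_K[OF r] by (auto simp: B_def intro!: NK.F_intros bexI[of _ "r * u"])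
  qed
  obtain m where m: "m \<in> J" "m \<noteq> 0"
    using J by (auto simp: NL.fractional_def)
  obtain N where N: "N > 0" "of_nat N * inverse m \<in> Z"
    using NL.denominator[OF NL.F_inverse] m JL by blast
  have NJ: "of_nat N \<in> J"
    using is_submodule_scale[OF JZ N(2) m(1)] m(2) by (simp add: mult.assoc)
  then have NA: "of_nat N \<in> A"
    using NK.F_intros(10) by (simp add: A_def)
  obtain d where d: "d \<in> Z" "d \<noteq> 0" "\<And>x. x \<in> J \<Longrightarrow> d * x \<in> Z"
    using J by (auto simp: NL.fractional_def)
  obtain D where D: "D > 0" "of_nat D * inverse d \<in> Z"
    using NL.denominator[OF NL.F_inverse[OF NL.R_F[OF d(1)]]] by blast
  have DJ: "of_nat D * x \<in> Z" if "x \<in> J" for x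
  proof -
    have "of_nat D * x = (of_nat D * inverse d) * (d * x)"
      using d(2) by simp
    also have "\<dots> \<in> Z"
      by (rule NL.R_mult[OF D(2) d(3)[OF that]])
    finally show ?thesis .
  qed
  have D_OK: "of_nat D \<in> OK"
    by (rule NK.R_intros(10))
  have AB: "a \<in> B" if "a \<in> A" for a
  proof -
    have "a \<in> K" "0 + a * \<eta> \<in> J"
      using that L_fractional_mult_eta[OF J, of a] by (auto simp: A_def mult.commute)
    then show ?thesis
      using NK.F_intros(2) unfolding B_def by blast
  qed
  have fracB: "NK.fractional B"
    unfolding NK.fractional_def
  proof (intro conjI)
    show "B \<subseteq> K"
      by (auto simp: B_def)
    show "is_submodule OK B"
      by (rule B)
    show "\<exists>x\<in>B. x \<noteq> 0"
      using AB[OF NA] N(1) by (intro bexI[of _ "of_nat N"]) auto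
    have "of_nat D * v \<in> OK" if "v \<in> B" for v
    proof -
      obtain u where u: "u \<in> K" "v \<in> K" "u + v * \<eta> \<in> J"
        using \<open>v \<in> B\<close> by (auto simp: B_def)
      have "of_nat D * u + (of_nat D * v) * \<eta> \<in> Z"
        using DJ[OF u(3)] by (simp add: algebra_simps)
      then show ?thesis
        using u by (intro OK_if_Z(2)[of "of_nat D * u"] NK.F_intros)
    qed
    then show "\<exists>d\<in>OK. d \<noteq> 0 \<and> (\<forall>x\<in>B. d * x \<in> OK)"
      using D_OK D(1) by (intro bexI[of _ "of_nat D"]) auto
  qed
  let ?B' = "NK.inverse_ideal B"
  obtain p q r t where pq: "p \<in> B" "q \<in> B" and rt: "r \<in> ?B'" "t \<in> ?B'" and one: "p * r + q * t = 1"
    using NK.fractional_two_generators[OF fracB] by blast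
  have B'K: "x \<in> K" if "x \<in> ?B'" for x
    using that by (simp add: NK.inverse_ideal_def)
  have B'B: "v * x \<in> OK" "x * v \<in> OK" if "x \<in> ?B'" "v \<in> B" for x v
    using NK.inverse_idealD[OF that] by (simp_all add: mult.commute)
  have BK: "v \<in> K" if "v \<in> B" for v
    using that by (simp add: B_def)
  have AK: "a \<in> K" and AJ: "a \<in> J" if "a \<in> A" for a
    using that by (simp_all add: A_def)
  obtain u\<^sub>p u\<^sub>q where up: "u\<^sub>p \<in> K" "u\<^sub>p + p * \<eta> \<in> J" and uq: "u\<^sub>q \<in> K" "u\<^sub>q + q * \<eta> \<in> J"
    using pq by (auto simp: B_def)
  \<comment> \<open>The projection of \<open>J\<close> to its \<open>\<eta>\<close>-coordinates
    \<open>B\<close> is split by \<open>v \<mapsto> v * s\<close>: as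
    \<open>v = (v * r) * p + (v * t) * q\<close> with coefficients in \<open>O_K\<close>, the chosen
    lifts of \<open>p\<close> and \<open>q\<close> combine to a lift of \<open>v\<close>.\<close>
  define u0 where "u0 = r * u\<^sub>p + t * u\<^sub>q"
  define s where "s = u0 + \<eta>"
  have u0K: "u0 \<in> K"
    unfolding u0_def by (intro NK.F_intros up uq B'K rt)
  have s_eq: "s = r * (u\<^sub>p + p * \<eta>) + t * (u\<^sub>q + q * \<eta>)"
  proof -
    have "r * (u\<^sub>p + p * \<eta>) + t * (u\<^sub>q + q * \<eta>) = u0 + (p * r + q * t) * \<eta>"
      by (simp add: u0_def algebra_simps)
    then show ?thesis
      by (simp add: one s_def)
  qed
  have vs: "v * s \<in> J" if v: "v \<in> B" for v
  proof -
    have "v * s = (v * r) * (u\<^sub>p + p * \<eta>) + (v * t) * (u\<^sub>q + q * \<eta>)"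
      unfolding s_eq by (simp add: algebra_simps)
    also have "\<dots> \<in> J"
      by (intro J_intros J_scale B'B rt v up uq)
    finally show ?thesis .
  qed
  have decomp: "\<exists>a\<in>A. \<exists>v\<in>B. x = a + v * s" if x: "x \<in> J" for x
  proof -
    obtain u v where uv: "u \<in> K" "v \<in> K" "x = u + v * \<eta>"
      using K_basis[of x] x JL by blast
    then have v: "v \<in> B"
      using x by (auto simp: B_def)
    have "x - v * s = u - v * u0"
      unfolding uv(3) s_def by (simp add: algebra_simps)
    moreover have "u - v * u0 \<in> K"
      by (intro NK.F_intros uv u0K)
    moreover have "x - v * s \<in> J"
      by (intro J_intros x vs v)
    ultimately have "x - v * s \<in> A"
      by (simp add: A_def)
    then show ?thesis
      using v by (intro bexI[of _ "x - v * s"] bexI[of _ v]) simp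
  qed
  have sumJ: "a + v * s \<in> J" if "a \<in> A" "v \<in> B" for a v
    by (intro J_intros AJ vs that)
  have u0: "u0 \<in> OK"
  proof (rule NK.stable_imp_mem[OF u0K NA])
    show "of_nat N \<noteq> (0 :: 'a)" "of_nat D \<noteq> (0 :: 'a)"
      using N D by auto
    show "of_nat D * a \<in> OK" if "a \<in> A" for a
      using DJ[OF AJ[OF that]] AK[OF that] by (auto intro!: NK.F_intros)
    fix a assume a: "a \<in> A"
    have "u0 * a = a * s - \<eta> * a"
      by (simp add: s_def algebra_simps)
    also have "\<dots> \<in> J"
      by (intro J_intros vs AB a AJ L_fractional_mult_eta[OF J])
    finally show "u0 * a \<in> A"
      using NK.F_intros(6)[OF u0K AK[OF a]] by (simp add: A_def)
  qed
  \<comment> \<open>Trace and norm of \<open>s\<close> over \<open>K\<close>.\<close>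
  define T where "T = \<tau> + 2 * u0"
  define Q where "Q = u0 * u0 + u0 * \<tau> + \<delta>"
  have T: "T \<in> OK" and Q: "Q \<in> OK"
    unfolding T_def Q_def using NK.R_intros(10)[of 2]
    by (intro NK.R_intros(4) NK.R_mult tau_OK delta_OK u0; simp)+
  have ss: "s * s = T * s - Q"
    unfolding T_def Q_def s_def using eta_square by (simp add: algebra_simps)
  have \<sigma>s: "\<sigma> s = T - s"
    unfolding s_def T_def \<tau>_def using u0K eta_L by (simp add: sigma_add K_L sigma_K)
  have sL: "s \<in> L"
    unfolding s_def by (intro NL.F_intros eta_L K_L u0K)
  have vQ: "v * Q \<in> A" if v: "v \<in> B" for v
  proof -
    have "v * Q = T * (v * s) - (u0 * (v * s) + \<eta> * (v * s))"
    proof -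
      have "v * (s * s) = v * (T * s - Q)"
        by (simp only: ss)
      then show ?thesis
        by (simp add: s_def algebra_simps)
    qed
    also have "\<dots> \<in> J"
      by (intro J_intros J_scale T u0 vs v L_fractional_mult_eta[OF J])
    finally show ?thesis
      using NK.F_intros(6)[OF BK[OF v] OK_K[OF Q]] by (simp add: A_def)
  qed
  have norm: "rel_norm L K (a + v * s) = a * a + a * v * T + v * v * Q" if "a \<in> K" "v \<in> K" for a v
  proof -
    have "rel_norm L K (a + v * s) = (a + v * s) * (a + v * (T - s))"
      using that sL by (simp add: rel_norm_eq sigma_add sigma_mult sigma_K K_L \<sigma>s NL.F_intros)
    also have "\<dots> = a * a + a * v * T + v * v * (T * s - s * s)"
      by (simp add: algebra_simps)
    finally show ?thesis
      by (simp add: ss)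
  qed
  obtain \<kappa> where \<kappa>: "\<kappa> \<in> K" "\<kappa> \<noteq> 0" and hull: "is_submodule OK hull (rel_norm L K ` J) = (\<lambda>r. r * \<kappa>) ` OK"
    using principal unfolding principal_ideals_def rel_ideal_norm_def ring_of_integers_K by auto
  have normJ: "rel_norm L K x / \<kappa> \<in> OK" if "x \<in> J" for x
  proof -
    have "rel_norm L K x \<in> (\<lambda>r. r * \<kappa>) ` OK"
      using that hull_subset[of "rel_norm L K ` J"] unfolding hull [symmetric] by blast
    then show ?thesis
      using \<kappa>(2) by auto
  qed
  \<comment> \<open>The norm of \<open>a + v * s\<close> is a sum of three terms in
    \<open>A B\<close>: \<open>a * a\<close> because \<open>A\<close> is contained in
    \<open>B\<close>, the mixed term, and \<open>v * v * Q\<close> because \<open>v * Q\<close> lies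
    in \<open>A\<close>.\<close>
  have \<kappa>AB: "\<kappa> \<in> NK.ideal_product A B"
  proof -
    have "\<kappa> \<in> (\<lambda>r. r * \<kappa>) ` OK"
      using NK.R_intros(1) by force
    moreover have "(is_submodule OK hull (rel_norm L K ` J)) \<subseteq> NK.ideal_product A B"
    proof (rule hull_minimal)
      show "is_submodule OK (NK.ideal_product A B)"
        by (rule NK.ideal_product_submodule[OF A])
      show "rel_norm L K ` J \<subseteq> NK.ideal_product A B"
      proof (rule image_subsetI)
        fix x assume "x \<in> J"
        then obtain a v where av: "a \<in> A" "v \<in> B" "x = a + v * s"
          using decomp by blast
        have "rel_norm L K x = a * a + (a * (T * v) + ((v * Q) * v + 0))"
          unfolding av(3) norm[OF AK[OF av(1)] BK[OF av(2)]] by (simp add: mult_ac)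
        also have "\<dots> \<in> NK.ideal_product A B"
          by (intro NK.ideal_product.intros av AB vQ is_submodule_scale[OF B] T)
        finally show "rel_norm L K x \<in> NK.ideal_product A B" .
      qed
    qed
    ultimately show ?thesis
      unfolding hull by blast
  qed
  have aa: "a * a / \<kappa> \<in> OK" if a: "a \<in> A" for a
    using normJ[OF sumJ[OF a is_submodule_zero[OF B]]] norm[OF AK[OF a] NK.F_intros(2)] by simp
  have vvQ: "v * v * Q / \<kappa> \<in> OK" if v: "v \<in> B" for v
    using normJ[OF sumJ[OF is_submodule_zero[OF A] v]] norm[OF NK.F_intros(2) BK[OF v]] by simp
  have avT: "a * v * T / \<kappa> \<in> OK" if av: "a \<in> A" "v \<in> B" for a v
  proof -
    have "a * v * T / \<kappa> = rel_norm L K (a + v * s) / \<kappa> - a * a / \<kappa> - v * v * Q / \<kappa>"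
      unfolding norm[OF AK[OF av(1)] BK[OF av(2)]] using \<kappa>(2) by (simp add: field_simps)
    also have "\<dots> \<in> OK"
      by (intro NK.R_intros(5) normJ sumJ aa vvQ av)
    finally show ?thesis .
  qed
  have aa': "a * a' / \<kappa> \<in> OK" if a: "a \<in> A" "a' \<in> A" for a a'
  proof (rule OK_if_square)
    show "a * a' / \<kappa> \<in> K"
      by (intro NK.F_divide NK.F_intros AK a \<kappa>)
    have "a * a' / \<kappa> * (a * a' / \<kappa>) = (a * a / \<kappa>) * (a' * a' / \<kappa>)"
      by simp
    also have "\<dots> \<in> OK"
      by (intro NK.R_mult aa a)
    finally show "a * a' / \<kappa> * (a * a' / \<kappa>) \<in> OK" .
  qed
  have vvQ': "v * v' * Q / \<kappa> \<in> OK" if v: "v \<in> B" "v' \<in> B" for v v'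
  proof (rule OK_if_square)
    show "v * v' * Q / \<kappa> \<in> K"
      by (intro NK.F_divide NK.F_intros BK v \<kappa> OK_K[OF Q])
    have "v * v' * Q / \<kappa> * (v * v' * Q / \<kappa>) = (v * v * Q / \<kappa>) * (v' * v' * Q / \<kappa>)"
      by simp
    also have "\<dots> \<in> OK"
      by (intro NK.R_mult vvQ v)
    finally show "v * v' * Q / \<kappa> * (v * v' * Q / \<kappa>) \<in> OK" .
  qed
  have av: "a * v / \<kappa> \<in> OK" if av: "a \<in> A" "v \<in> B" for a v
  proof -
    define y where "y = a * v / \<kappa>"
    have yK: "y \<in> K"
      unfolding y_def by (intro NK.F_divide NK.F_intros AK BK av \<kappa>)
    \<comment> \<open>The norms only give \<open>y * T \<in> O_K\<close>, and \<open>T\<close> may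
      fail to be a unit. Instead \<open>y * s\<close> is shown to multiply \<open>J\<close> into
      itself, and \<open>y\<close> is read off as its \<open>\<eta>\<close>-coordinate.\<close>
    have "y * s \<in> Z"
    proof (rule NL.stable_imp_mem[OF _ m _ d(2,3)])
      show "y * s \<in> L"
        by (intro NL.F_intros sL K_L yK)
      fix x assume "x \<in> J"
      then obtain a' v' where av': "a' \<in> A" "v' \<in> B" "x = a' + v' * s"
        using decomp by blast
      have "y * s * x = y * a' * s + y * v' * (s * s)"
        unfolding av'(3) by (simp add: algebra_simps)
      also have "\<dots> = (a * a' / \<kappa>) * (v * s) + ((a * v * T / \<kappa>) * (v' * s) - (v * v' * Q / \<kappa>) * a)"
        unfolding ss y_def by (simp add: algebra_simps diff_divide_distrib)
      also have "\<dots> \<in> J"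
        by (intro J_intros J_scale aa' avT vvQ' vs AJ av av')
      finally show "y * s * x \<in> J" .
    qed
    then have "y * u0 + y * \<eta> \<in> Z"
      by (simp add: s_def algebra_simps)
    then show ?thesis
      unfolding y_def [symmetric] by (intro OK_if_Z(2)[of "y * u0"] yK u0K NK.F_intros)
  qed
  have \<kappa>B': "\<kappa> * x \<in> A" if x: "x \<in> ?B'" for x
  proof -
    have "x * k \<in> A" if "k \<in> NK.ideal_product A B" for k
      using that
    proof induction
      case zero
      then show ?case using is_submodule_zero[OF A] by simp
    next
      case (step a b k)
      have "(x * b) * a + x * k \<in> A"
        by (rule is_submodule_add[OF A is_submodule_scale[OF A B'B(2)[OF x step(2)] step(1)]])
          (rule step.IH)
      then show ?case
        by (simp add: algebra_simps)
    qed
    from this[OF \<kappa>AB] show ?thesis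
      by (simp add: mult.commute)
  qed
  \<comment> \<open>The rows \<open>(- t, p)\<close> and \<open>(r, q)\<close> form a matrix of
    determinant \<open>- (p * r + q * t) = - 1\<close> with first column in \<open>B^-1\<close> and
    second in \<open>B\<close>, so \<open>\<alpha>\<close>, \<open>\<beta>\<close> is a basis of
    \<open>\<kappa> B^-1 + B s\<close>.\<close>
  define \<alpha> where "\<alpha> = \<kappa> * - t + p * s"
  define \<beta> where "\<beta> = \<kappa> * r + q * s"
  have "- t \<in> ?B'"
    by (rule is_submodule_minus[OF NK.ring NK.inverse_ideal_submodule rt(2)])
  then have "\<alpha> \<in> J"
    unfolding \<alpha>_def by (intro sumJ \<kappa>B' pq)
  moreover have "\<beta> \<in> J"
    unfolding \<beta>_def by (intro sumJ \<kappa>B' rt pq)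
  ultimately have "x * \<alpha> + y * \<beta> \<in> J" if "x \<in> OK" "y \<in> OK" for x y
    using that by (intro J_intros J_scale)
  moreover have "\<exists>x\<in>OK. \<exists>y\<in>OK. z = x * \<alpha> + y * \<beta>" if z: "z \<in> J" for z
  proof -
    obtain a v where z: "a \<in> A" "v \<in> B" "z = a + v * s"
      using decomp[OF z] by blast
    define X where "X = a / \<kappa>"
    have X: "X \<in> ?B'"
      using av[OF z(1)] AK[OF z(1)] \<kappa> by (auto simp: NK.inverse_ideal_def X_def simp del: Int_iff intro: NK.F_divide)
    have "(v * r - X * q) * \<alpha> + (X * p + v * t) * \<beta> =
        \<kappa> * (X * (p * r + q * t)) + v * (p * r + q * t) * s"
      unfolding \<alpha>_def \<beta>_def by (simp add: algebra_simps)
    then have "z = (v * r - X * q) * \<alpha> + (X * p + v * t) * \<beta>"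
      using \<kappa> by (simp add: one z(3) X_def)
    moreover have "v * r - X * q \<in> OK" "X * p + v * t \<in> OK"
      by (intro NK.R_intros(4,5) B'B X rt z pq)+
    ultimately show ?thesis
      by blast
  qed
  ultimately have "J = {x * \<alpha> + y * \<beta> | x y. x \<in> OK \<and> y \<in> OK}"
    by blast
  then show ?thesis
    by blast
qed

end

section \<open>Representations and ideal classes\<close>

lemma card_image_eq_if_same_kernel:
  assumes "\<And>x y. x \<in> A \<Longrightarrow> y \<in> A \<Longrightarrow> f x = f y \<longleftrightarrow> g x = g y"
  shows "card (f ` A) = card (g ` A)"
proof -
  have "bij_betw (\<lambda>z. g (inv_into A f z)) (f ` A) (g ` A)"
  proof (rule bij_betw_byWitness[where f' = "\<lambda>z. f (inv_into A g z)"])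
    show "\<forall>z\<in>f ` A. f (inv_into A g (g (inv_into A f z))) = z"
      using assms by (metis (no_types, lifting) f_inv_into_f imageI inv_into_into)
    show "\<forall>z\<in>g ` A. g (inv_into A f (f (inv_into A g z))) = z"
      using assms by (metis (no_types, lifting) f_inv_into_f imageI inv_into_into)
  qed (auto intro: inv_into_into)
  then show ?thesis
    by (rule bij_betw_same_card)
qed

section \<open>Matrices over a subring and conjugacy\<close>

definition over :: "'a set \<Rightarrow> 'a^'n^'m \<Rightarrow> bool" where
  "over R A \<longleftrightarrow> (\<forall>i j. A $ i $ j \<in> R)"

lemma over_matrix_mult:
  fixes A :: "'a::field^'n^'m"
  shows "is_subring R \<Longrightarrow> over R A \<Longrightarrow> over R B \<Longrightarrow> over R (A ** B)"
  by (auto simp: over_def matrix_matrix_mult_def intro!: subring_sum subring_mult)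

lemma over_mono: "over R A \<Longrightarrow> R \<subseteq> S \<Longrightarrow> over S A"
  by (auto simp: over_def)

lemma over_mat_1: "is_subring R \<Longrightarrow> over R (mat 1 :: 'a::field^'n^'n)"
  by (auto simp: over_def mat_def intro: subring_one subring_zero)

lemma carrier_GL2:
  "A \<in> carrier (GL2 R) \<longleftrightarrow> over R A \<and> (\<exists>B. over R B \<and> A ** B = mat 1 \<and> B ** A = mat 1)"
  by (simp add: GL2_def over_def)

lemma GL2_mult [simp]: "A \<otimes>\<^bsub>GL2 R\<^esub> B = A ** B" and GL2_one [simp]: "\<one>\<^bsub>GL2 R\<^esub> = mat 1"
  by (simp_all add: GL2_def)

lemma group_GL2:
  fixes R :: "'a::field set"
  assumes R: "is_subring R"
  shows "group (GL2 R)"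
proof (rule groupI)
  fix x y assume "x \<in> carrier (GL2 R)" "y \<in> carrier (GL2 R)"
  then obtain x' y' where *: "over R x" "over R x'" "over R y" "over R y'"
    "x ** x' = mat 1" "x' ** x = mat 1" "y ** y' = mat 1" "y' ** y = mat 1"
    unfolding carrier_GL2 by blast
  have "(x ** y) ** (y' ** x') = x ** (y ** y') ** x'" "(y' ** x') ** (x ** y) = y' ** (x' ** x) ** y"
    by (simp_all only: matrix_mul_assoc)
  then have "(x ** y) ** (y' ** x') = mat 1" "(y' ** x') ** (x ** y) = mat 1"
    using * by simp_all
  then show "x \<otimes>\<^bsub>GL2 R\<^esub> y \<in> carrier (GL2 R)"
    using over_matrix_mult[OF R] * unfolding carrier_GL2 GL2_mult by blast
next
  show "\<one>\<^bsub>GL2 R\<^esub> \<in> carrier (GL2 R)"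
    using over_mat_1[OF R] unfolding carrier_GL2 GL2_one by (metis matrix_mul_lid)
next
  fix x assume "x \<in> carrier (GL2 R)"
  then show "\<exists>y\<in>carrier (GL2 R). y \<otimes>\<^bsub>GL2 R\<^esub> x = \<one>\<^bsub>GL2 R\<^esub>"
    unfolding carrier_GL2 Bex_def GL2_mult GL2_one by metis
qed (simp_all add: matrix_mul_assoc)

text \<open>In the intertwining form no inverse occurs, so both sides can be compared on an
  eigenvector.\<close>

lemma conjugate_homs_GL2_iff:
  fixes R :: "'a::field set" and \<phi> \<psi> :: "'g \<Rightarrow> 'a^2^2"
  assumes R: "is_subring R"
  shows "conjugate_homs C (GL2 R) \<phi> \<psi> \<longleftrightarrow>
    (\<exists>P\<in>carrier (GL2 R). \<forall>g\<in>carrier C. \<psi> g ** P = P ** \<phi> g)"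
  unfolding conjugate_homs_def
proof (intro bex_cong ball_cong refl)
  interpret group "GL2 R"
    by (rule group_GL2[OF R])
  fix P g assume P: "P \<in> carrier (GL2 R)"
  let ?Q = "inv\<^bsub>GL2 R\<^esub> P"
  have Q: "P ** ?Q = mat 1" "?Q ** P = mat 1"
    using l_inv[OF P] r_inv[OF P] by simp_all
  show "\<psi> g = P \<otimes>\<^bsub>GL2 R\<^esub> \<phi> g \<otimes>\<^bsub>GL2 R\<^esub> ?Q \<longleftrightarrow> \<psi> g ** P = P ** \<phi> g"
  proof
    assume "\<psi> g = P \<otimes>\<^bsub>GL2 R\<^esub> \<phi> g \<otimes>\<^bsub>GL2 R\<^esub> ?Q"
    then have "\<psi> g ** P = (P ** \<phi> g) ** (?Q ** P)"
      by (simp add: matrix_mul_assoc)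
    then show "\<psi> g ** P = P ** \<phi> g"
      by (simp add: Q)
  next
    assume *: "\<psi> g ** P = P ** \<phi> g"
    have "\<psi> g = \<psi> g ** (P ** ?Q)"
      by (simp add: Q)
    then show "\<psi> g = P \<otimes>\<^bsub>GL2 R\<^esub> \<phi> g \<otimes>\<^bsub>GL2 R\<^esub> ?Q"
      by (simp add: matrix_mul_assoc *)
  qed
qed

lemma matrix_vector_mult_2:
  fixes A :: "'a::field^2^2"
  shows "(A *v v) $ 1 = A $ 1 $ 1 * v $ 1 + A $ 1 $ 2 * v $ 2"
    and "(A *v v) $ 2 = A $ 2 $ 1 * v $ 1 + A $ 2 $ 2 * v $ 2"
  by (simp_all add: matrix_vector_mult_def sum_2)

context cyclotomic_involution
begin

section \<open>Ideal classes as orbits under scaling\<close>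

definition ideal_class :: "'a set \<Rightarrow> 'a set set" where
  "ideal_class J = {(*) x ` J | x. x \<in> L \<and> x \<noteq> 0}"

text \<open>Multiplying \<open>J\<close> by the principal ideal of \<open>x\<close> gives
  \<open>x J\<close>, already a module, so the hull adds nothing. The restricted carrier
  \<open>S\<close> does not enter the formation of cosets.\<close>

lemma r_coset_principal:
  assumes "NL.fractional J"
  shows "principal_ideals L #>\<^bsub>(ideal_group L)\<lparr>carrier := S\<rparr>\<^esub> J = ideal_class J"
proof -
  have J: "is_submodule Z J"
    using assms by (simp add: NL.fractional_def)
  have "is_submodule Z hull {a * b | a b. a \<in> (\<lambda>r. r * x) ` Z \<and> b \<in> J} = (*) x ` J" for x
  proof -
    have "{a * b | a b. a \<in> (\<lambda>r. r * x) ` Z \<and> b \<in> J} = (*) x ` J"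
    proof (intro equalityI subsetI)
      fix y assume "y \<in> {a * b | a b. a \<in> (\<lambda>r. r * x) ` Z \<and> b \<in> J}"
      then obtain r b where "r \<in> Z" "b \<in> J" "y = x * (r * b)"
        by (auto simp: mult_ac)
      then show "y \<in> (*) x ` J"
        using is_submodule_scale[OF J] by blast
    next
      fix y assume "y \<in> (*) x ` J"
      then obtain b where "b \<in> J" "y = (1 * x) * b"
        by auto
      then show "y \<in> {a * b | a b. a \<in> (\<lambda>r. r * x) ` Z \<and> b \<in> J}"
        using Z_intros(1) by blast
    qed
    then show ?thesis
      using is_submodule_image_mult[OF J, of x] by (simp add: hull_same)
  qed
  then show ?thesis
    unfolding r_coset_def principal_ideals_def ideal_group_def ideal_class_def ring_of_integers_L
    by auto
qed

lemma carrier_rel_class_group: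
  "carrier (rel_class_group L K) =
    ideal_class ` {J. NL.fractional J \<and> rel_ideal_norm L K J \<in> principal_ideals K}"
  unfolding rel_class_group_def FactGroup_def RCOSETS_def
  using NL.fractional_iff[OF ring_of_integers_L [symmetric]] r_coset_principal by auto

lemma ideal_class_eq_if:
  assumes "x \<in> L" "x \<noteq> 0"
  shows "ideal_class ((*) x ` J) = ideal_class J"
proof (intro equalityI subsetI)
  fix I assume "I \<in> ideal_class ((*) x ` J)"
  then obtain y where "y \<in> L" "y \<noteq> 0" "I = (*) (y * x) ` J"
    by (auto simp: ideal_class_def image_image mult.assoc)
  then show "I \<in> ideal_class J"
    unfolding ideal_class_def using assms NL.F_intros(6) by auto
next
  fix I assume "I \<in> ideal_class J"
  then obtain y where y: "y \<in> L" "y \<noteq> 0" "I = (*) y ` J"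
    by (auto simp: ideal_class_def)
  then have "I = (*) (y / x) ` ((*) x ` J)"
    using assms by (simp add: image_image)
  moreover have "y / x \<in> L" "y / x \<noteq> 0"
    using y assms NL.F_divide by auto
  ultimately show "I \<in> ideal_class ((*) x ` J)"
    unfolding ideal_class_def by blast
qed

lemma ideal_class_eqD:
  assumes "ideal_class I = ideal_class J"
  obtains x where "x \<in> L" "x \<noteq> 0" "I = (*) x ` J"
proof -
  have "I = (*) 1 ` I"
    by simp
  then have "I \<in> ideal_class I"
    unfolding ideal_class_def using NL.F_intros(1) by (intro CollectI exI[of _ 1]) simp
  then have "I \<in> ideal_class J"
    unfolding assms by simp
  then show ?thesis
    using that by (auto simp: ideal_class_def)
qed

section \<open>Eigenvectors and the lattices they span\<close>

definition eta_vector :: "'a^2 \<Rightarrow> bool" where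
  "eta_vector v \<longleftrightarrow> v \<noteq> 0 \<and> (\<forall>i. v $ i \<in> L) \<and> (\<exists>A. over K A \<and> A *v v = \<eta> *s v)"

definition OK_span :: "'a^2 \<Rightarrow> 'a set" where
  "OK_span v = {x * v $ 1 + y * v $ 2 | x y. x \<in> OK \<and> y \<in> OK}"

text \<open>The eigenvalue \<open>\<eta>\<close> is not in \<open>K\<close>, so the entries of an eigenvector form a \<open>K\<close>-basis of \<open>L\<close>.\<close>

lemma eta_vector_basis:
  assumes "eta_vector v"
  shows "x \<in> K \<Longrightarrow> y \<in> K \<Longrightarrow> x * v $ 1 + y * v $ 2 = 0 \<Longrightarrow> x = 0 \<and> y = 0"
    and "z \<in> L \<Longrightarrow> \<exists>x\<in>K. \<exists>y\<in>K. z = x * v $ 1 + y * v $ 2"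
proof -
  obtain A where v: "v \<noteq> 0" "\<And>i. v $ i \<in> L" and A: "over K A" "A *v v = \<eta> *s v"
    using assms by (auto simp: eta_vector_def)
  define a b c d where "a = A $ 1 $ 1" "b = A $ 1 $ 2" "c = A $ 2 $ 1" "d = A $ 2 $ 2"
  note abcd = this
  have K: "a \<in> K" "b \<in> K" "c \<in> K" "d \<in> K"
    using A(1) by (auto simp: abcd over_def)
  have e1: "a * v $ 1 + b * v $ 2 = \<eta> * v $ 1" and e2: "c * v $ 1 + d * v $ 2 = \<eta> * v $ 2"
    using A(2) unfolding vec_eq_iff forall_2 matrix_vector_mult_2 by (simp_all add: abcd)
  have v': "v $ 1 \<noteq> 0 \<or> v $ 2 \<noteq> 0"
    using v(1) by (auto simp: vec_eq_iff forall_2)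
  have not: "\<eta> \<noteq> a" "\<eta> \<noteq> d"
    using K eta_notin_K by auto
  have v1: "v $ 1 \<noteq> 0"
  proof
    assume "v $ 1 = 0"
    then show False
      using e2 v' not by simp
  qed
  have b: "b \<noteq> 0"
    using e1 v1 not by auto
  have v2: "v $ 2 = (\<eta> - a) / b * v $ 1"
    using e1 b by (simp add: field_simps)
  show "x = 0 \<and> y = 0" if xy: "x \<in> K" "y \<in> K" "x * v $ 1 + y * v $ 2 = 0" for x y
  proof -
    have "(x + y * ((\<eta> - a) / b)) * v $ 1 = 0"
      using xy(3) unfolding v2 by (simp add: algebra_simps)
    then have "x + y * ((\<eta> - a) / b) = 0"
      using v1 by simp
    then have "(x * b - y * a) + y * \<eta> = 0 + 0 * \<eta>"
      using b by (simp add: field_simps)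
    moreover have "x * b - y * a \<in> K"
      by (intro NK.F_intros xy K)
    ultimately have "y = 0" "x * b - y * a = 0"
      using K_basis_unique[of "x * b - y * a" y 0 0] xy(2) NK.F_intros(2) by blast+
    then show ?thesis
      using b by simp
  qed
  show "\<exists>x\<in>K. \<exists>y\<in>K. z = x * v $ 1 + y * v $ 2" if z: "z \<in> L"
  proof -
    obtain s t where st: "s \<in> K" "t \<in> K" "z / v $ 1 = s + t * \<eta>"
      using K_basis[OF NL.F_divide[OF z v(2)[of 1]]] by blast
    have "z = (s + t * \<eta>) * v $ 1"
      using st(3) v1 by (simp add: field_simps)
    also have "\<dots> = (s + t * a) * v $ 1 + (t * b) * v $ 2"
      unfolding v2 using b by (simp add: field_simps)
    finally show ?thesis
      using st K by (intro bexI[of _ "s + t * a"] bexI[of _ "t * b"] NK.F_intros)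
  qed
qed

text \<open>Each row of \<open>A - B\<close> is a \<open>K\<close>-linear relation between the
  entries of \<open>v\<close>, and these are independent.\<close>

lemma matrix_eq_if_eta_vector:
  assumes v: "eta_vector v" and "over K A" "over K B" "A *v v = B *v v"
  shows "A = B"
proof -
  have "(A $ i $ 1 - B $ i $ 1) * v $ 1 + (A $ i $ 2 - B $ i $ 2) * v $ 2 = 0" for i
    using assms(4) unfolding vec_eq_iff
    by (simp add: matrix_vector_mult_def sum_2 algebra_simps)
  then have "A $ i $ 1 - B $ i $ 1 = 0 \<and> A $ i $ 2 - B $ i $ 2 = 0" for i
    using assms(2,3) by (intro eta_vector_basis(1)[OF v]) (auto simp: over_def intro: NK.F_intros)
  then show ?thesis
    by (simp add: vec_eq_iff forall_2)
qed

lemma ex_matrix_K: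
  assumes "eta_vector v" "\<And>i. w $ i \<in> L"
  shows "\<exists>P. over K P \<and> w = P *v v"
proof -
  have "\<exists>x y. x \<in> K \<and> y \<in> K \<and> w $ i = x * v $ 1 + y * v $ 2" for i
    using eta_vector_basis(2)[OF assms(1) assms(2)[of i]] by blast
  then obtain f g where *: "\<And>i. f i \<in> K \<and> g i \<in> K \<and> w $ i = f i * v $ 1 + g i * v $ 2"
    by metis
  show ?thesis
    by (rule exI[of _ "\<chi> i j. if j = 1 then f i else g i"])
      (use * in \<open>simp add: over_def vec_eq_iff matrix_vector_mult_def sum_2\<close>)
qed

lemma ex_matrix_OK:
  assumes "\<And>i. w $ i \<in> OK_span v"
  shows "\<exists>P. over OK P \<and> w = P *v v"
proof -
  have "\<exists>x y. x \<in> OK \<and> y \<in> OK \<and> w $ i = x * v $ 1 + y * v $ 2" for i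
    using assms[of i] by (auto simp: OK_span_def)
  then obtain f g where *: "\<And>i. f i \<in> OK \<and> g i \<in> OK \<and> w $ i = f i * v $ 1 + g i * v $ 2"
    by metis
  show ?thesis
    by (rule exI[of _ "\<chi> i j. if j = 1 then f i else g i"])
      (use * in \<open>simp add: over_def vec_eq_iff matrix_vector_mult_def sum_2\<close>)
qed

lemma GL2_if_mutual:
  assumes v: "eta_vector v" and w: "eta_vector w" and R: "is_subring R" "R \<subseteq> K"
    and P: "over R P" "w = P *v v" and Q: "over R Q" "v = Q *v w"
  shows "P \<in> carrier (GL2 R)"
proof -
  have "(Q ** P) *v v = mat 1 *v v" "(P ** Q) *v w = mat 1 *v w"
    using P(2) Q(2) by (simp_all flip: matrix_vector_mul_assoc)
  moreover have "over K (mat 1)" "over K (Q ** P)" "over K (P ** Q)"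
    using over_matrix_mult[OF R(1)] over_mat_1[OF NK.F_subring] P(1) Q(1) R(2)
    by (auto intro: over_mono)
  ultimately have "Q ** P = mat 1" "P ** Q = mat 1"
    using matrix_eq_if_eta_vector v w by blast+
  then show ?thesis
    using P(1) Q(1) unfolding carrier_GL2 by blast
qed

lemma OK_span_mult_subset:
  assumes "over OK P"
  shows "OK_span (P *v v) \<subseteq> OK_span v"
proof
  fix z assume "z \<in> OK_span (P *v v)"
  then obtain x y where xy: "x \<in> OK" "y \<in> OK" "z = x * (P *v v) $ 1 + y * (P *v v) $ 2"
    by (auto simp: OK_span_def)
  then have "z = (x * P $ 1 $ 1 + y * P $ 2 $ 1) * v $ 1 + (x * P $ 1 $ 2 + y * P $ 2 $ 2) * v $ 2"
    unfolding matrix_vector_mult_2 by (simp add: algebra_simps)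
  moreover have P: "P $ i $ j \<in> OK" for i j
    using assms by (simp add: over_def)
  have "x * P $ 1 $ 1 + y * P $ 2 $ 1 \<in> OK" "x * P $ 1 $ 2 + y * P $ 2 $ 2 \<in> OK"
    by (intro NK.R_intros(4) NK.R_mult xy P)+
  ultimately show "z \<in> OK_span v"
    unfolding OK_span_def by blast
qed

lemma OK_span_GL2:
  assumes "P \<in> carrier (GL2 OK)"
  shows "OK_span (P *v v) = OK_span v"
proof -
  obtain Q where P: "over OK P" and Q: "over OK Q" "Q ** P = mat 1"
    using assms unfolding carrier_GL2 by blast
  have "v = Q *v (P *v v)"
    using Q(2) by (simp add: matrix_vector_mul_assoc)
  then show ?thesis
    using OK_span_mult_subset[OF P, of v] OK_span_mult_subset[OF Q(1), of "P *v v"] by auto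
qed

lemma mem_OK_span: "v $ i \<in> OK_span v"
proof -
  have "v $ 1 = 1 * v $ 1 + 0 * v $ 2" "v $ 2 = 0 * v $ 1 + 1 * v $ 2"
    by simp_all
  then have "v $ 1 \<in> OK_span v" "v $ 2 \<in> OK_span v"
    using NK.R_intros(1,2) unfolding OK_span_def by blast+
  then show ?thesis
    using exhaust_2[of i] by auto
qed

lemma OK_span_scale: "OK_span (x *s v) = (*) x ` OK_span v"
proof -
  have "a * (x * v $ 1) + b * (x * v $ 2) = x * (a * v $ 1 + b * v $ 2)" for a b
    by (simp add: algebra_simps)
  then show ?thesis
    unfolding OK_span_def by auto
qed

text \<open>Integrality of \<open>A\<close> makes the span stable under \<open>\<eta>\<close>, and
  \<open>Z = O_K + O_K \<eta>\<close> then makes it a \<open>Z\<close>-module.\<close>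

lemma fractional_OK_span:
  assumes v: "eta_vector v" and A: "over OK A" "A *v v = \<eta> *s v"
  shows "NL.fractional (OK_span v)"
  unfolding NL.fractional_def
proof (intro conjI)
  have vL: "v $ i \<in> L" for i
    using v by (simp add: eta_vector_def)
  show "OK_span v \<subseteq> L"
    unfolding OK_span_def by (auto intro!: NL.F_intros(4,6) vL intro: K_L)
  have add: "x + y \<in> OK_span v" if xy: "x \<in> OK_span v" "y \<in> OK_span v" for x y
  proof -
    obtain a b a' b' where "a \<in> OK" "b \<in> OK" "x = a * v $ 1 + b * v $ 2"
      "a' \<in> OK" "b' \<in> OK" "y = a' * v $ 1 + b' * v $ 2"
      using xy by (auto simp: OK_span_def)
    moreover from this have "x + y = (a + a') * v $ 1 + (b + b') * v $ 2"
      by (simp add: algebra_simps)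
    ultimately show ?thesis
      unfolding OK_span_def using NK.R_intros(4) by blast
  qed
  have scale: "r * x \<in> OK_span v" if r: "r \<in> OK" and x: "x \<in> OK_span v" for r x
  proof -
    obtain a b where "a \<in> OK" "b \<in> OK" "x = a * v $ 1 + b * v $ 2"
      using x by (auto simp: OK_span_def)
    moreover from this have "r * x = (r * a) * v $ 1 + (r * b) * v $ 2"
      by (simp add: algebra_simps)
    ultimately show ?thesis
      unfolding OK_span_def using NK.R_mult r by blast
  qed
  have eta: "\<eta> * x \<in> OK_span v" if "x \<in> OK_span v" for x
  proof -
    have "\<eta> * x \<in> OK_span (\<eta> *s v)"
      using that unfolding OK_span_scale by blast
    then show ?thesis
      using OK_span_mult_subset[OF A(1), of v] by (auto simp: A(2))
  qed
  show "is_submodule Z (OK_span v)"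
    unfolding is_submodule_def
  proof (intro conjI ballI add)
    show "0 \<in> OK_span v"
      using scale[OF NK.R_intros(2) mem_OK_span] by simp
    fix r x assume "r \<in> Z" and x: "x \<in> OK_span v"
    then obtain s t where "s \<in> OK" "t \<in> OK" "r = s + t * \<eta>"
      using OK_basis by blast
    then have "s * x + t * (\<eta> * x) \<in> OK_span v" "r * x = s * x + t * (\<eta> * x)"
      using x by (auto intro!: add scale eta simp: algebra_simps)
    then show "r * x \<in> OK_span v"
      by simp
  qed
  show "\<exists>x\<in>OK_span v. x \<noteq> 0"
    using v mem_OK_span by (auto simp: eta_vector_def vec_eq_iff)
  obtain N1 N2 where N: "N1 > 0" "of_nat N1 * v $ 1 \<in> Z" "N2 > 0" "of_nat N2 * v $ 2 \<in> Z"
    using NL.denominator[OF vL] by metis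
  have "of_nat (N1 * N2) * x \<in> Z" if x: "x \<in> OK_span v" for x
  proof -
    obtain a b where ab: "a \<in> OK" "b \<in> OK" "x = a * v $ 1 + b * v $ 2"
      using x by (auto simp: OK_span_def)
    have "of_nat (N1 * N2) * x = a * of_nat N2 * (of_nat N1 * v $ 1) + b * of_nat N1 * (of_nat N2 * v $ 2)"
      unfolding ab(3) by (simp add: algebra_simps)
    also have "\<dots> \<in> Z"
      by (intro NL.R_intros(4) NL.R_mult N NL.R_intros(10) OK_Z ab)
    finally show ?thesis .
  qed
  then show "\<exists>d\<in>Z. d \<noteq> 0 \<and> (\<forall>x\<in>OK_span v. d * x \<in> Z)"
    using N(1,3) NL.R_intros(10)[of "N1 * N2"] by (intro bexI[of _ "of_nat (N1 * N2)"]) auto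
qed

text \<open>The first row of \<open>A\<close> fixes the ratio of the two entries, so the eigenspace
  is a line.\<close>

lemma eta_vector_unique:
  assumes A: "over K A" and v: "eta_vector v" "A *v v = \<eta> *s v" and w: "eta_vector w" "A *v w = \<eta> *s w"
  obtains x where "x \<in> L" "x \<noteq> 0" "w = x *s v"
proof -
  have *: "u $ 1 \<noteq> 0 \<and> A $ 1 $ 2 \<noteq> 0 \<and> u $ 2 = (\<eta> - A $ 1 $ 1) / A $ 1 $ 2 * u $ 1"
    if u: "eta_vector u" "A *v u = \<eta> *s u" for u
  proof -
    have nz: "u $ i \<noteq> 0" for i
      using eta_vector_basis(1)[OF u(1), of 1 0] eta_vector_basis(1)[OF u(1), of 0 1]
        NK.F_intros(1,2) exhaust_2[of i] by auto
    have e: "A $ 1 $ 1 * u $ 1 + A $ 1 $ 2 * u $ 2 = \<eta> * u $ 1"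
      using arg_cong[OF u(2), of "\<lambda>x. x $ 1"] by (simp add: matrix_vector_mult_2)
    moreover have "\<eta> \<noteq> A $ 1 $ 1"
      using A eta_notin_K by (auto simp: over_def)
    ultimately have "A $ 1 $ 2 \<noteq> 0"
      using nz[of 1] by auto
    then show ?thesis
      using e nz[of 1] by (simp add: field_simps)
  qed
  have "w = (w $ 1 / v $ 1) *s v"
    using *[OF v] *[OF w] by (simp add: vec_eq_iff forall_2)
  moreover have "w $ 1 / v $ 1 \<in> L" "w $ 1 / v $ 1 \<noteq> 0"
    using *[OF v] *[OF w] v(1) w(1) NL.F_divide by (auto simp: eta_vector_def)
  ultimately show ?thesis
    using that by blast
qed

end

section \<open>The character of a cyclic group\<close>

locale cyclotomic_character = cyclotomic_involution n \<eta> \<sigma> + C: group C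
  for n and \<eta> :: "'a::field_char_0" and \<sigma> and C :: "('g, 'b) monoid_scheme" (structure) +
  fixes g0 :: 'g and chi :: "'g \<Rightarrow> 'a"
  assumes g0: "g0 \<in> carrier C" and cyclic: "carrier C = generate C {g0}"
    and chi: "chi \<in> hom C (mult_group L)" and chi_g0: "chi g0 = \<eta>"
begin

lemma chi_nonzero: "g \<in> carrier C \<Longrightarrow> chi g \<noteq> 0"
  and chi_mult: "g \<in> carrier C \<Longrightarrow> h \<in> carrier C \<Longrightarrow> chi (g \<otimes> h) = chi g * chi h"
  using chi by (auto simp: hom_def mult_group_def)

lemma chi_one: "chi \<one> = 1"
  using chi_mult[OF C.one_closed C.one_closed] chi_nonzero[OF C.one_closed] by simp

lemma chi_inv: "g \<in> carrier C \<Longrightarrow> chi (inv g) = inverse (chi g)"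
  using chi_mult[of g "inv g"] chi_one by (simp add: inverse_unique)

lemma carrier_induct [consumes 1, case_names one gen inv_gen mult]:
  assumes "g \<in> carrier C" "P \<one>" "P g0" "P (inv g0)"
    "\<And>g h. g \<in> carrier C \<Longrightarrow> h \<in> carrier C \<Longrightarrow> P g \<Longrightarrow> P h \<Longrightarrow> P (g \<otimes> h)"
  shows "P g"
proof -
  have "g \<in> generate C {g0}"
    using assms(1) cyclic by simp
  then show ?thesis
  proof (induction rule: generate.induct)
    case (eng h1 h2)
    then show ?case
      using assms(5) cyclic by blast
  qed (use assms(2-4) in auto)
qed

lemma chi_Z: "g \<in> carrier C \<Longrightarrow> chi g \<in> Z"
proof (induction rule: carrier_induct)
  case inv_gen
  have "\<eta> * \<eta> ^ (n - 1) = 1"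
    using eta_power_n n_pos by (simp flip: power_Suc)
  then have "inverse \<eta> = \<eta> ^ (n - 1)"
    by (rule inverse_unique)
  then show ?case
    using g0 by (simp add: chi_inv chi_g0 Z_intros eta_in_Z)
qed (auto simp: chi_one chi_g0 chi_mult Z_intros eta_in_Z)

definition character_vector :: "('g \<Rightarrow> 'a^2^2) \<Rightarrow> 'a^2 \<Rightarrow> bool" where
  "character_vector \<phi> v \<longleftrightarrow>
     v \<noteq> 0 \<and> (\<forall>i. v $ i \<in> L) \<and> (\<forall>g\<in>carrier C. over K (\<phi> g) \<and> \<phi> g *v v = chi g *s v)"

lemma character_vectorD: "character_vector \<phi> v \<Longrightarrow> g \<in> carrier C \<Longrightarrow> \<phi> g *v v = chi g *s v"
  and character_vector_over: "character_vector \<phi> v \<Longrightarrow> g \<in> carrier C \<Longrightarrow> over K (\<phi> g)"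
  by (auto simp: character_vector_def)

lemma character_vector_g0: "character_vector \<phi> v \<Longrightarrow> \<phi> g0 *v v = \<eta> *s v"
  using character_vectorD[of \<phi> v g0] g0 chi_g0 by simp

lemma character_vector_eta: "character_vector \<phi> v \<Longrightarrow> eta_vector v"
  unfolding eta_vector_def using character_vector_g0 character_vector_over g0
  by (metis character_vector_def)

lemma character_vector_scale:
  assumes "character_vector \<phi> v" "x \<in> L" "x \<noteq> 0"
  shows "character_vector \<phi> (x *s v)"
  using assms unfolding character_vector_def
  by (auto simp: vector_scalar_commute mult.commute intro: NL.F_intros(6))

lemma hom_GL2:
  assumes "\<phi> \<in> hom C (GL2 R)"
  shows "g \<in> carrier C \<Longrightarrow> over R (\<phi> g)"
    and "g \<in> carrier C \<Longrightarrow> h \<in> carrier C \<Longrightarrow> \<phi> (g \<otimes> h) = \<phi> g ** \<phi> h"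
  using assms by (auto simp: hom_def carrier_GL2)

lemma hom_GL2_one:
  assumes "\<phi> \<in> hom C (GL2 R)" "is_subring R"
  shows "\<phi> \<one> = mat 1"
proof -
  interpret G: group "GL2 R"
    by (rule group_GL2[OF assms(2)])
  show ?thesis
    using group_hom.hom_one[of C "GL2 R" \<phi>] assms(1) C.group_axioms G.group_axioms
    by (simp add: group_hom_def group_hom_axioms_def)
qed

text \<open>An eigenvector of the generator is one for all of \<open>C\<close>, as the condition
  passes to products and to the inverse of \<open>g0\<close>.\<close>

lemma character_vectorI:
  assumes \<phi>: "\<phi> \<in> hom C (GL2 K)" and v: "v \<noteq> 0" "\<And>i. v $ i \<in> L" "\<phi> g0 *v v = \<eta> *s v"
  shows "character_vector \<phi> v"
proof -
  have one: "\<phi> \<one> *v v = chi \<one> *s v"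
    using hom_GL2_one[OF \<phi> NK.F_subring] by (simp add: chi_one)
  have "\<phi> g *v v = chi g *s v" if "g \<in> carrier C" for g
    using that
  proof (induction rule: carrier_induct)
    case inv_gen
    have "\<phi> (inv g0) *v (\<phi> g0 *v v) = \<phi> \<one> *v v"
      using hom_GL2(2)[OF \<phi>, of "inv g0" g0] g0 by (simp add: matrix_vector_mul_assoc)
    then have "\<eta> *s (\<phi> (inv g0) *v v) = v"
      using one by (simp add: v(3) vector_scalar_commute chi_one)
    moreover have "\<eta> \<noteq> 0"
      using chi_nonzero[OF g0] by (simp add: chi_g0)
    ultimately have "\<phi> (inv g0) *v v = inverse \<eta> *s v"
      by (metis vector_smult_assoc left_inverse vector_smult_lid)
    then show ?case
      using g0 by (simp add: chi_inv chi_g0)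
  next
    case (mult g h)
    then show ?case
      using hom_GL2(2)[OF \<phi>, of g h]
      by (simp add: chi_mult vector_scalar_commute mult.commute flip: matrix_vector_mul_assoc)
  qed (use one v(3) chi_g0 in auto)
  then show ?thesis
    using v hom_GL2(1)[OF \<phi>] by (simp add: character_vector_def)
qed

lemma character_vector_conjugate:
  assumes v: "character_vector \<phi> v" and P: "P \<in> carrier (GL2 K)"
    and conj: "\<And>g. g \<in> carrier C \<Longrightarrow> \<psi> g ** P = P ** \<phi> g"
    and \<psi>: "\<And>g. g \<in> carrier C \<Longrightarrow> over K (\<psi> g)"
  shows "character_vector \<psi> (P *v v)"
proof -
  obtain Q where Q: "over K P" "Q ** P = mat 1"
    using P unfolding carrier_GL2 by blast
  have "P *v v \<noteq> 0"
  proof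
    assume "P *v v = 0"
    then have "(Q ** P) *v v = 0"
      by (simp flip: matrix_vector_mul_assoc)
    then show False
      using v Q(2) by (simp add: character_vector_def)
  qed
  moreover have "(P *v v) $ i \<in> L" for i
    using v Q(1) by (auto simp: matrix_vector_mult_def character_vector_def over_def
        intro!: NL.F_intros(8) NL.F_intros(6) intro: K_L)
  moreover have "\<psi> g *v (P *v v) = chi g *s (P *v v)" if g: "g \<in> carrier C" for g
  proof -
    have "\<psi> g *v (P *v v) = P *v (\<phi> g *v v)"
      by (simp add: matrix_vector_mul_assoc conj[OF g])
    then show ?thesis
      by (simp add: character_vectorD[OF v g] vector_scalar_commute)
  qed
  ultimately show ?thesis
    using \<psi> by (simp add: character_vector_def)
qed

text \<open>The trace at \<open>g0\<close> and at its square determines the determinant of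
  \<open>A = \<rho> g0\<close> through \<open>tr(A^2) = tr(A)^2 - 2 det A\<close>. Hence
  \<open>\<eta>\<close> is a root of the characteristic polynomial of \<open>A\<close>.\<close>

lemma ex_character_vector:
  assumes \<rho>: "\<rho> \<in> hom C (GL2 K)" and tr: "\<forall>g\<in>carrier C. trace (\<rho> g) = chi g + \<sigma> (chi g)"
  shows "\<exists>v. character_vector \<rho> v"
proof -
  define A where "A = \<rho> g0"
  define a b c d where "a = A $ 1 $ 1" "b = A $ 1 $ 2" "c = A $ 2 $ 1" "d = A $ 2 $ 2"
  note abcd = this
  have K: "a \<in> K" "b \<in> K" "c \<in> K" "d \<in> K"
    using hom_GL2(1)[OF \<rho> g0] by (auto simp: abcd over_def A_def)
  have 1: "a + d = \<tau>"
    using tr g0 chi_g0 by (simp add: trace_def sum_2 abcd A_def \<tau>_def)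
  have "trace (\<rho> (g0 \<otimes> g0)) = \<eta> * \<eta> + \<sigma> \<eta> * \<sigma> \<eta>"
    using tr g0 by (simp add: chi_mult chi_g0 sigma_mult eta_L)
  moreover have "trace (\<rho> (g0 \<otimes> g0)) = a * a + 2 * b * c + d * d"
    using hom_GL2(2)[OF \<rho> g0 g0]
    by (simp add: trace_def sum_2 matrix_matrix_mult_def abcd A_def algebra_simps)
  ultimately have "a * a + 2 * b * c + d * d = (a + d) * (a + d) - 2 * \<delta>"
    unfolding 1 by (simp add: \<tau>_def \<delta>_def algebra_simps)
  then have "2 * \<delta> = 2 * (a * d - b * c)"
    by (simp add: algebra_simps)
  then have 2: "\<delta> = a * d - b * c"
    by (simp only: mult_cancel_left) simp
  have ad: "(\<eta> - a) * (\<eta> - d) = b * c"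
    using eta_square unfolding 1 [symmetric] 2 by (simp add: algebra_simps)
  have "b \<noteq> 0"
    using ad K eta_notin_K by auto
  \<comment> \<open>A solution of the first row of \<open>(A - \<eta>) v = 0\<close>; the second row
    is the vanishing of the determinant.\<close>
  define v :: "'a^2" where "v = (\<chi> i. if i = 1 then b else \<eta> - a)"
  have v: "v $ 1 = b" "v $ 2 = \<eta> - a"
    by (simp_all add: v_def)
  have "A *v v = \<eta> *s v"
    unfolding vec_eq_iff forall_2 matrix_vector_mult_2
    using ad by (simp add: v abcd [symmetric] algebra_simps)
  moreover have "v \<noteq> 0"
    using v(1) \<open>b \<noteq> 0\<close> by auto
  moreover have "v $ i \<in> L" for i
    using K by (auto simp: v_def intro!: NL.F_intros eta_L intro: K_L)
  ultimately show ?thesis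
    using character_vectorI[OF \<rho>] by (auto simp: A_def)
qed

end

section \<open>Conjugacy classes and ideal classes\<close>

locale cyclotomic_representation = cyclotomic_character n \<eta> \<sigma> C g0 chi
  for n and \<eta> :: "'a::field_char_0" and \<sigma> and C :: "('g, 'b) monoid_scheme" (structure) and g0 chi +
  fixes \<rho> :: "'g \<Rightarrow> 'a^2^2"
  assumes \<rho>: "\<rho> \<in> hom C (GL2 K)"
    and trace_\<rho>: "\<forall>g\<in>carrier C. trace (\<rho> g) = chi g + \<sigma> (chi g)"
begin

abbreviation "X \<equiv> homs_conjugate_to C OK K \<rho>"

lemma X_hom: "\<phi> \<in> X \<Longrightarrow> \<phi> \<in> hom C (GL2 OK)"
  by (simp add: homs_conjugate_to_def)

lemma X_character_vector:
  assumes "\<phi> \<in> X"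
  shows "\<exists>v. character_vector \<phi> v"
proof -
  obtain w where w: "character_vector \<rho> w"
    using ex_character_vector[OF \<rho> trace_\<rho>] by blast
  have "\<exists>P\<in>carrier (GL2 K). \<forall>g\<in>carrier C. \<phi> g ** P = P ** \<rho> g"
    using assms unfolding homs_conjugate_to_def conjugate_homs_GL2_iff[OF NK.F_subring] by blast
  then obtain P where P: "P \<in> carrier (GL2 K)" "\<And>g. g \<in> carrier C \<Longrightarrow> \<phi> g ** P = P ** \<rho> g"
    by blast
  have "over K (\<phi> g)" if "g \<in> carrier C" for g
    using over_mono[OF hom_GL2(1)[OF X_hom[OF assms] that]] by blast
  then show ?thesis
    using character_vector_conjugate[OF w P] by blast
qed

definition hom_class :: "('g \<Rightarrow> 'a^2^2) \<Rightarrow> 'a set set" where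
  "hom_class \<phi> = ideal_class (OK_span (SOME v. character_vector \<phi> v))"

lemma hom_class_eq:
  assumes "character_vector \<phi> v"
  shows "hom_class \<phi> = ideal_class (OK_span v)"
proof -
  define w where "w = (SOME v. character_vector \<phi> v)"
  have w: "character_vector \<phi> w"
    unfolding w_def using assms by (rule someI)
  obtain x where "x \<in> L" "x \<noteq> 0" "w = x *s v"
    using eta_vector_unique[OF character_vector_over[OF assms g0]] assms w
      character_vector_eta character_vector_g0 by metis
  then show ?thesis
    unfolding hom_class_def w_def [symmetric] by (simp add: OK_span_scale ideal_class_eq_if)
qed

lemma hom_class_mem:
  assumes "\<phi> \<in> X"
  shows "hom_class \<phi> \<in> carrier (rel_class_group L K)"
proof -
  obtain v where v: "character_vector \<phi> v"
    using X_character_vector[OF assms] by blast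
  have "NL.fractional (OK_span v)"
    using v character_vector_eta character_vector_g0 hom_GL2(1)[OF X_hom[OF assms] g0]
    by (intro fractional_OK_span[of v "\<phi> g0"])
  moreover from this have "rel_ideal_norm L K (OK_span v) \<in> principal_ideals K"
    by (rule principal_norm_if_basis[OF _ OK_span_def])
  ultimately show ?thesis
    unfolding carrier_rel_class_group hom_class_eq[OF v] by blast
qed

lemma hom_class_eq_iff:
  assumes \<phi>: "\<phi> \<in> X" and \<psi>: "\<psi> \<in> X"
  shows "hom_class \<phi> = hom_class \<psi> \<longleftrightarrow> conjugate_homs C (GL2 OK) \<phi> \<psi>"
  unfolding conjugate_homs_GL2_iff[OF NK.ring]
proof
  obtain v where v: "character_vector \<phi> v"
    using X_character_vector[OF \<phi>] by blast
  show "hom_class \<phi> = hom_class \<psi>"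
    if conj: "\<exists>P\<in>carrier (GL2 OK). \<forall>g\<in>carrier C. \<psi> g ** P = P ** \<phi> g"
  proof -
    obtain P where P: "P \<in> carrier (GL2 OK)" "\<And>g. g \<in> carrier C \<Longrightarrow> \<psi> g ** P = P ** \<phi> g"
      using conj by blast
    have "P \<in> carrier (GL2 K)"
      using P(1) over_mono[of OK _ K] unfolding carrier_GL2 by blast
    moreover have "over K (\<psi> g)" if "g \<in> carrier C" for g
      using over_mono[OF hom_GL2(1)[OF X_hom[OF \<psi>] that]] by blast
    ultimately have "character_vector \<psi> (P *v v)"
      using character_vector_conjugate[OF v _ P(2)] by blast
    then show ?thesis
      by (simp add: hom_class_eq[OF v] hom_class_eq OK_span_GL2[OF P(1)])
  qed
  show "\<exists>P\<in>carrier (GL2 OK). \<forall>g\<in>carrier C. \<psi> g ** P = P ** \<phi> g" if eq: "hom_class \<phi> = hom_class \<psi>"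
  proof -
    obtain w' where w': "character_vector \<psi> w'"
      using X_character_vector[OF \<psi>] by blast
    obtain x where x: "x \<in> L" "x \<noteq> 0" "OK_span v = (*) x ` OK_span w'"
      using ideal_class_eqD[of "OK_span v" "OK_span w'"] eq
      unfolding hom_class_eq[OF v] hom_class_eq[OF w'] by blast
    \<comment> \<open>After rescaling, both eigenvectors span the same lattice, so each is an
      \<open>O_K\<close>-matrix times the other.\<close>
    define w where "w = x *s w'"
    have w: "character_vector \<psi> w"
      unfolding w_def by (rule character_vector_scale[OF w' x(1,2)])
    have span: "OK_span v = OK_span w"
      by (simp add: x(3) w_def OK_span_scale)
    obtain P where P: "over OK P" "w = P *v v"
      using ex_matrix_OK[of w v] mem_OK_span[of w] span by auto
    obtain Q where Q: "over OK Q" "v = Q *v w"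
      using ex_matrix_OK[of v w] mem_OK_span[of v] span by auto
    have OK: "is_subring OK" "OK \<subseteq> K"
      using NK.ring by auto
    have "\<psi> g ** P = P ** \<phi> g" if g: "g \<in> carrier C" for g
    proof (rule matrix_eq_if_eta_vector[OF character_vector_eta[OF v]])
      have "over K P"
        using P(1) OK(2) by (rule over_mono)
      then show "over K (\<psi> g ** P)" "over K (P ** \<phi> g)"
        using character_vector_over v w g by (auto intro!: over_matrix_mult[OF NK.F_subring])
      have "(\<psi> g ** P) *v v = chi g *s w"
        using character_vectorD[OF w g] by (simp add: P(2) flip: matrix_vector_mul_assoc)
      also have "\<dots> = (P ** \<phi> g) *v v"
        by (simp add: P(2) character_vectorD[OF v g] vector_scalar_commute flip: matrix_vector_mul_assoc)
      finally show "(\<psi> g ** P) *v v = (P ** \<phi> g) *v v" .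
    qed
    moreover have "P \<in> carrier (GL2 OK)"
      using GL2_if_mutual[OF character_vector_eta[OF v] character_vector_eta[OF w] OK P Q] .
    ultimately show ?thesis
      by blast
  qed
qed

text \<open>\<open>\<phi> g\<close> is the matrix of multiplication by \<open>chi g\<close> in an
  \<open>O_K\<close>-basis of \<open>J\<close>; uniqueness of such matrices makes
  \<open>\<phi>\<close> a homomorphism. A change of basis over \<open>K\<close> between the
  eigenvectors conjugates \<open>\<rho>\<close> to it.\<close>

lemma hom_class_surj:
  assumes J: "NL.fractional J" and principal: "rel_ideal_norm L K J \<in> principal_ideals K"
  shows "\<exists>\<phi>\<in>X. hom_class \<phi> = ideal_class J"
proof -
  obtain \<alpha> \<beta> where J_eq: "J = {x * \<alpha> + y * \<beta> | x y. x \<in> OK \<and> y \<in> OK}"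
    using basis_if_principal_norm[OF J principal] by blast
  define v :: "'a^2" where "v = (\<chi> i. if i = 1 then \<alpha> else \<beta>)"
  have span: "OK_span v = J"
    by (simp add: OK_span_def J_eq v_def)
  have JL: "J \<subseteq> L" and JZ: "is_submodule Z J"
    using J by (auto simp: NL.fractional_def)
  have vJ: "v $ i \<in> J" for i
    using mem_OK_span[of v i] span by simp
  have ex: "\<exists>M. over OK M \<and> z *s v = M *v v" if "z \<in> Z" for z
    using that by (intro ex_matrix_OK) (simp add: span is_submodule_scale[OF JZ] vJ)
  have v0: "v \<noteq> 0"
  proof
    assume "v = 0"
    then have "J \<subseteq> {0}"
      unfolding span [symmetric] by (auto simp: OK_span_def)
    then show False
      using J by (auto simp: NL.fractional_def)
  qed
  have ev: "eta_vector v"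
    unfolding eta_vector_def
  proof (intro conjI allI)
    show "\<exists>A. over K A \<and> A *v v = \<eta> *s v"
      using ex[OF eta_in_Z] by (metis over_mono Int_lower2)
  qed (use v0 vJ JL in auto)
  define \<phi> where "\<phi> = restrict (\<lambda>g. SOME M. over OK M \<and> chi g *s v = M *v v) (carrier C)"
  have \<phi>: "over OK (\<phi> g)" "\<phi> g *v v = chi g *s v" if "g \<in> carrier C" for g
    using someI_ex[OF ex[OF chi_Z[OF that]]] that by (simp_all add: \<phi>_def)
  have \<phi>K: "over K (\<phi> g)" if "g \<in> carrier C" for g
    using over_mono[OF \<phi>(1)[OF that]] by blast
  have cv: "character_vector \<phi> v"
    using v0 vJ JL \<phi>(2) \<phi>K by (auto simp: character_vector_def)
  have mult: "\<phi> (g \<otimes> h) = \<phi> g ** \<phi> h" if gh: "g \<in> carrier C" "h \<in> carrier C" for g h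
  proof (rule matrix_eq_if_eta_vector[OF ev])
    show "\<phi> (g \<otimes> h) *v v = (\<phi> g ** \<phi> h) *v v"
      using gh by (simp add: \<phi>(2) chi_mult vector_scalar_commute mult.commute flip: matrix_vector_mul_assoc)
  qed (use gh in \<open>auto intro!: \<phi>K over_matrix_mult[OF NK.F_subring]\<close>)
  have one: "\<phi> \<one> = mat 1"
    by (rule matrix_eq_if_eta_vector[OF ev])
      (auto simp: \<phi>(2) chi_one intro!: \<phi>K over_mat_1[OF NK.F_subring])
  have hom: "\<phi> \<in> hom C (GL2 OK)"
  proof (rule homI)
    fix g assume g: "g \<in> carrier C"
    then have "\<phi> g ** \<phi> (inv g) = mat 1" "\<phi> (inv g) ** \<phi> g = mat 1"
      using mult[of g "inv g"] mult[of "inv g" g] one by auto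
    then show "\<phi> g \<in> carrier (GL2 OK)"
      unfolding carrier_GL2 using \<phi>(1) g by blast
  qed (simp add: mult)
  obtain w where w: "character_vector \<rho> w"
    using ex_character_vector[OF \<rho> trace_\<rho>] by blast
  have ew: "eta_vector w"
    by (rule character_vector_eta[OF w])
  obtain P where P: "over K P" "v = P *v w"
    using ex_matrix_K[OF ew, of v] vJ JL by blast
  obtain Q where Q: "over K Q" "w = Q *v v"
    using ex_matrix_K[OF ev, of w] w by (auto simp: character_vector_def)
  have "P \<in> carrier (GL2 K)"
    using GL2_if_mutual[OF ew ev NK.F_subring subset_refl P Q] .
  moreover have "\<phi> g ** P = P ** \<rho> g" if g: "g \<in> carrier C" for g
  proof (rule matrix_eq_if_eta_vector[OF ew])
    show "over K (\<phi> g ** P)" "over K (P ** \<rho> g)"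
      using \<phi>K character_vector_over[OF w] g P(1) by (auto intro!: over_matrix_mult[OF NK.F_subring])
    have "(\<phi> g ** P) *v w = chi g *s v"
      by (simp add: \<phi>(2)[OF g] flip: matrix_vector_mul_assoc P(2))
    also have "\<dots> = (P ** \<rho> g) *v w"
      by (simp add: P(2) character_vectorD[OF w g] vector_scalar_commute flip: matrix_vector_mul_assoc)
    finally show "(\<phi> g ** P) *v w = (P ** \<rho> g) *v w" .
  qed
  ultimately have "conjugate_homs C (GL2 K) \<rho> \<phi>"
    unfolding conjugate_homs_GL2_iff[OF NK.F_subring] by blast
  then have "\<phi> \<in> X"
    using hom by (simp add: homs_conjugate_to_def \<phi>_def)
  then show ?thesis
    using hom_class_eq[OF cv] span by auto
qed

theorem card_conjugacy_classes:
  "card (conjugacy_classes C (GL2 OK) X) = rel_class_number L K"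
proof -
  define r where "r = {(\<phi>, \<psi>). \<phi> \<in> X \<and> \<psi> \<in> X \<and> conjugate_homs C (GL2 OK) \<phi> \<psi>}"
  have r: "r `` {\<phi>} = {\<psi> \<in> X. hom_class \<phi> = hom_class \<psi>}" if "\<phi> \<in> X" for \<phi>
    using that hom_class_eq_iff by (auto simp: r_def)
  have "conjugacy_classes C (GL2 OK) X = (\<lambda>\<phi>. r `` {\<phi>}) ` X"
    by (auto simp: conjugacy_classes_def quotient_def r_def)
  also have "card \<dots> = card (hom_class ` X)"
    using r by (intro card_image_eq_if_same_kernel) auto
  also have "hom_class ` X = carrier (rel_class_group L K)"
  proof
    show "hom_class ` X \<subseteq> carrier (rel_class_group L K)"
      using hom_class_mem by (rule image_subsetI)
    show "carrier (rel_class_group L K) \<subseteq> hom_class ` X"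
    proof
      fix c assume "c \<in> carrier (rel_class_group L K)"
      then obtain J where "c = ideal_class J" "NL.fractional J" "rel_ideal_norm L K J \<in> principal_ideals K"
        unfolding carrier_rel_class_group by auto
      then show "c \<in> hom_class ` X"
        using hom_class_surj[of J] by auto
    qed
  qed
  finally show ?thesis
    by (simp add: rel_class_number_def Coset.order_def)
qed

end

theorem theorem3:
  fixes n :: nat
    and \<eta> :: "'a::field_char_0"
    and L K :: "'a set"
    and C :: "('g, 'b) monoid_scheme"
    and g0 :: 'g
    and chi :: "'g \<Rightarrow> 'a"
    and \<sigma> :: "'a \<Rightarrow> 'a"
    and \<rho> :: "'g \<Rightarrow> 'a^2^2"
  assumes "n \<ge> 3"
    and "primitive_root_of_unity n \<eta>"
    and "L = adjoin \<rat> \<eta>"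
    and "group C"
    and "g0 \<in> carrier C"
    and "carrier C = generate C {g0}"
    and "Coset.order C = n"
    and "chi \<in> hom C (mult_group L)"
    and "chi g0 = \<eta>"
    and "\<sigma> \<in> Gal L \<rat>"
    and "\<exists>x\<in>L. \<sigma> x \<noteq> x"
    and "\<forall>x\<in>L. \<sigma> (\<sigma> x) = x"
    and "K = fixed_field L \<sigma>"
    and "\<rho> \<in> hom C (GL2 K)"
    and "\<forall>g\<in>carrier C. trace (\<rho> g) = chi g + \<sigma> (chi g)"
  shows "card (conjugacy_classes C (GL2 (ring_of_integers K))
                 (homs_conjugate_to C (ring_of_integers K) K \<rho>))
         = rel_class_number L K"
proof -
  interpret I: cyclotomic_involution n \<eta> \<sigma>
    using assms by (intro cyclotomic_involution.intro cyclotomic.intro cyclotomic_involution_axioms.intro) simp_all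
  have K: "K = I.K"
    using assms by (simp add: I.K_def)
  interpret cyclotomic_representation n \<eta> \<sigma> C g0 chi \<rho>
    using assms K by (intro cyclotomic_representation.intro cyclotomic_character.intro
        cyclotomic_character_axioms.intro cyclotomic_representation_axioms.intro
        I.cyclotomic_involution_axioms) simp_all
  show ?thesis
    using card_conjugacy_classes assms(3) by (simp add: K I.ring_of_integers_K)
qed

end
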